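(* Fix an integer $d\ge 1$, parameters $0<\alpha<\beta<\infty$, constants $M,\tilde M>0$ satisfying $M/(2^{4\beta+1}\tilde M)\ge 1$, and a noise level $\sigma^2\ge 0$. Let $D=d(1/\alpha-1/\beta)$ and let $\mathcal{G}_{\alpha,\beta,0}$ be the class of all CSO problems on $[0,1]^d$ satisfying conditions (A1)–(A3) below with these $\alpha,\beta,M,\tilde M,\sigma$. Then for any admissible algorithm (as defined below) there exist constants $b_{1},b_{3}>0$ and $b_5>0$, independent of $n$ and $\sigma^2$, such that for all budgets $n\ge \max\{b_{1}\sigma^2,\,b_{3}\}$, $$\sup_{\mathcal{CSO}\in\mathcal{G}_{\alpha,\beta,0}}\mathbb{E}_{\mathcal{CSO}}\bigl[y(\mathbf{x}^* )-y(\hat{\mathbf{x}}_n^* )\bigr]\ \ge\ b_5\cdot\max\Bigl\{\bigl(\sigma^2/n\bigr)^{\frac{1}{D+2}},\ n^{-\frac{1}{D}}\Bigr\},$$ where $\hat{\mathbf{x}}_n^*$ is the output of the algorithm run with budget $n$ on $\mathcal{CSO}$ and $\mathbf{x}^*$ is the maximizer of its objective $y$.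
   Context: A CSO problem consists of an unknown objective $y:[0,1]^d\to\mathbb{R}$; an algorithm may query a point $\mathbf{x}\in[0,1]^d$ and observes $Y(\mathbf{x})=y(\mathbf{x})+\varepsilon(\mathbf{x})$. Norms are $\|\mathbf{x}\|_\infty=\max_l|x_l|$. Conditions: (A1) $y$ has a unique maximizer $\mathbf{x}^*$ over $[0,1]^d$; (A2) given $\mathbf{x}$, the noise $\varepsilon(\mathbf{x})$ is independent of everything else and satisfies $\mathbb{E}[\exp(\lambda\varepsilon(\mathbf{x}))]\le\exp(\lambda^2\sigma^2/2)$ for all $\lambda\in\mathbb{R}$; (A3) $\tilde M\|\mathbf{x}^*-\mathbf{x}\|_\infty^\beta\le |y(\mathbf{x}^* )-y(\mathbf{x})|\le M\|\mathbf{x}^*-\mathbf{x}\|_\infty^\alpha$ for all $\mathbf{x}\in[0,1]^d$. An algorithm with budget $n$ is admissible if: (i) the first query $\mathbf{x}_1$ is deterministic or a measurable function of a random vector $U_1$; (ii) for $t=1,\dots,n-1$, $\mathbf{x}_{t+1}$ is a measurable function of $\mathbf{x}_1,Y(\mathbf{x}_1),\dots,\mathbf{x}_t,Y(\mathbf{x}_t)$ and a random vector $U_{t+1}$; (iii) the output $\hat{\mathbf{x}}_n^*$ is a measurable function of $\mathbf{x}_1,Y(\mathbf{x}_1),\dots,\mathbf{x}_n,Y(\mathbf{x}_n)$ and a random vector $U_n^*$; (iv) $\hat{\mathbf{x}}_n^*\in\{\mathbf{x}_1,\dots,\mathbf{x}_n\}$; here $U_1,\dots,U_n,U_n^*$ are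 independent random vectors, independent of the noise. An "algorithm" means such a rule specified for each budget $n$. $\mathbb{E}_{\mathcal{CSO}}$ is expectation over the randomness of noise and algorithm on problem $\mathcal{CSO}$. The condition $M/(2^{4\beta+1}\tilde M)\ge1$ is a standing requirement the paper imposes on the constants. *)

theory Defs
  imports "HOL-Analysis.Analysis" "HOL-Probability.Probability"
begin

definition unit_cube :: "(real ^ 'd::finite) set" where
  "unit_cube = {x. \<forall>i. 0 \<le> x $ i \<and> x $ i \<le> 1}"

text \<open>A history of length t: the pairs (x_i, Y(x_i)) for i < t (0-based),
  an element of the product space over the index set {..<t}.\<close>
type_synonym 'd hist = "nat \<Rightarrow> (real ^ 'd) \<times> real"

definition hist_space :: "nat \<Rightarrow> ('d::finite) hist measure" where
  "hist_space t = PiM {..<t} (\<lambda>_. borel)"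

text \<open>A CSO problem is a pair (y, K): the objective y and the noise kernel K,
  where K x is the distribution of the noise \<epsilon>(x) at query point x.
  Each query draws fresh noise from K x, independently of everything else.\<close>

text \<open>Randomized adaptive algorithm with budget n:
  Q n t h is the (conditional) distribution of the query x_t (0-based, t < n)
  given the history h of length t (for t = 0 the history is trivial, so Q n 0 h
  is just the distribution of the first query); Out n h is the conditional
  distribution of the output given the full history of length n.\<close>

primrec run :: "((real ^ 'd::finite) \<Rightarrow> real) \<Rightarrow> ((real ^ 'd) \<Rightarrow> real measure)
    \<Rightarrow> (nat \<Rightarrow> 'd hist \<Rightarrow> (real ^ 'd) measure) \<Rightarrow> nat \<Rightarrow> 'd hist measure" where
  "run y K Q 0 = return (hist_space 0) (\<lambda>_. undefined)"
| "run y K Q (Suc t) =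
     run y K Q t \<bind> (\<lambda>h. Q t h \<bind> (\<lambda>x. K x \<bind>
        (\<lambda>e. return (hist_space (Suc t)) (h(t := (x, y x + e))))))"

definition output_dist ::
  "((real ^ 'd::finite) \<Rightarrow> real) \<Rightarrow> ((real ^ 'd) \<Rightarrow> real measure)
   \<Rightarrow> (nat \<Rightarrow> nat \<Rightarrow> 'd hist \<Rightarrow> (real ^ 'd) measure)
   \<Rightarrow> (nat \<Rightarrow> 'd hist \<Rightarrow> (real ^ 'd) measure) \<Rightarrow> nat \<Rightarrow> (real ^ 'd) measure" where
  "output_dist y K Q Out n = run y K (Q n) n \<bind> Out n"

text \<open>Admissible algorithm (conditions (i)-(iv)), given as Markov kernels
  (a measurable function of the history and an independent random vector is
  the same thing as a measurable Markov kernel from histories).\<close>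
definition admissible ::
  "(nat \<Rightarrow> nat \<Rightarrow> ('d::finite) hist \<Rightarrow> (real ^ 'd) measure)
   \<Rightarrow> (nat \<Rightarrow> 'd hist \<Rightarrow> (real ^ 'd) measure) \<Rightarrow> bool" where
  "admissible Q Out \<longleftrightarrow>
     (\<forall>n\<ge>1.
        (\<forall>t<n. Q n t \<in> measurable (hist_space t) (prob_algebra borel)
               \<and> (\<forall>h\<in>space (hist_space t). AE x in Q n t h. x \<in> unit_cube))
      \<and> Out n \<in> measurable (hist_space n) (prob_algebra borel)
      \<and> (\<forall>h\<in>space (hist_space n). AE x in Out n h. \<exists>i<n. x = fst (h i)))"

text \<open>The maximizer x* of y over [0,1]^d (unique under (A1)).\<close>
definition maximizer :: "((real ^ 'd::finite) \<Rightarrow> real) \<Rightarrow> real ^ 'd" where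
  "maximizer y = (THE x. x \<in> unit_cube \<and> (\<forall>z\<in>unit_cube. y z \<le> y x))"

definition CSO_class ::
  "real \<Rightarrow> real \<Rightarrow> real \<Rightarrow> real \<Rightarrow> real
   \<Rightarrow> ((((real ^ 'd::finite) \<Rightarrow> real) \<times> ((real ^ 'd) \<Rightarrow> real measure)) set)" where
  "CSO_class \<alpha> \<beta> M Mt sigma2 =
     {(y, K). y \<in> borel_measurable borel
        \<and> K \<in> measurable borel (prob_algebra borel)
        \<and> (\<exists>!x. x \<in> unit_cube \<and> (\<forall>z\<in>unit_cube. y z \<le> y x))
        \<and> (\<forall>x\<in>unit_cube. \<forall>l::real.
              integrable (K x) (\<lambda>e. exp (l * e))
            \<and> (\<integral>e. exp (l * e) \<partial>K x) \<le> exp (l\<^sup>2 * sigma2 / 2))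
        \<and> (\<forall>x\<in>unit_cube.
              Mt * infnorm (maximizer y - x) powr \<beta> \<le> \<bar>y (maximizer y) - y x\<bar>
            \<and> \<bar>y (maximizer y) - y x\<bar> \<le> M * infnorm (maximizer y - x) powr \<alpha>)}"

definition expected_regret ::
  "((real ^ 'd::finite) \<Rightarrow> real) \<Rightarrow> ((real ^ 'd) \<Rightarrow> real measure)
   \<Rightarrow> (nat \<Rightarrow> nat \<Rightarrow> 'd hist \<Rightarrow> (real ^ 'd) measure)
   \<Rightarrow> (nat \<Rightarrow> 'd hist \<Rightarrow> (real ^ 'd) measure) \<Rightarrow> nat \<Rightarrow> ennreal" where
  "expected_regret y K Q Out n =
     (\<integral>\<^sup>+ x. ennreal (y (maximizer y) - y x) \<partial>output_dist y K Q Out n)"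

end

theory Submission
  imports Defs
begin

text \<open>
  Perturb the background objective \<open>-c \<bar>x\<bar>\<^sup>\<beta>\<close>, within distance \<open>R \<sim> h\<^bsup>1/\<beta>\<^esup>\<close> of its
  maximizer \<open>0\<close>, by a bump of height \<open>h\<close> supported on one of \<open>N \<sim> h\<^bsup>-D\<^esup>\<close> disjoint cubes of
  radius \<open>r \<sim> h\<^bsup>1/\<alpha>\<^esup>\<close>; an output outside the cube of the bump has regret at least \<open>h\<close>. Running
  the algorithm on the background, some cube receives on average at most \<open>n/N\<close> queries and is output
  with small probability. Without noise the two problems cannot be told apart unless the cube is visited,
  so \<open>N \<ge> 12 n\<close>, i.e. \<open>h \<sim> n\<^bsup>-1/D\<^esup>\<close>, is admissible. With Gaussian noise the divergence of the two
  histories is of order \<open>(h/\<sigma>)\<^sup>2\<close> times the expected number of visits, which allows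
  \<open>n h\<^sup>2 / \<sigma>\<^sup>2 \<sim> N\<close>, i.e. \<open>h \<sim> (\<sigma>\<^sup>2/n)\<^bsup>1/(D+2)\<^esup>\<close>.
\<close>

section \<open>Integration against the law of the history\<close>

lemma measurable_history_upd:
  fixes y :: "real ^ 'd::finite \<Rightarrow> real"
  assumes [measurable]: "y \<in> borel_measurable borel"
  shows "(\<lambda>((h, x), e). h(t := (x, y x + e)))
    \<in> measurable ((hist_space t \<Otimes>\<^sub>M borel) \<Otimes>\<^sub>M borel) (hist_space (Suc t))"
  unfolding hist_space_def case_prod_beta
  by (rule measurable_fun_upd[where J="{..<t}"]) (auto simp flip: borel_prod)

lemma measurable_observe:
  fixes y :: "real ^ 'd::finite \<Rightarrow> real"
  assumes y: "y \<in> borel_measurable borel" and K: "K \<in> measurable borel (prob_algebra borel)"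
  shows "(\<lambda>(h, x). K x \<bind> (\<lambda>e. return (hist_space (Suc t)) (h(t := (x, y x + e)))))
    \<in> measurable (hist_space t \<Otimes>\<^sub>M borel) (prob_algebra (hist_space (Suc t)))"
  unfolding case_prod_beta
proof (rule measurable_bind_prob_space2[where N = borel])
  show "(\<lambda>p. K (snd p)) \<in> measurable (hist_space t \<Otimes>\<^sub>M borel) (prob_algebra borel)"
    using K by measurable
  show "(\<lambda>(p, e). return (hist_space (Suc t)) ((fst p)(t := (snd p, y (snd p) + e))))
      \<in> measurable ((hist_space t \<Otimes>\<^sub>M borel) \<Otimes>\<^sub>M borel) (prob_algebra (hist_space (Suc t)))"
    using measurable_compose[OF measurable_history_upd[OF y, of t] measurable_return_prob_space]
    by (simp add: case_prod_beta)
qed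

text \<open>One budget \<open>n\<close> is fixed and \<open>q\<close> stands for \<open>Q n\<close>.
  Laws of histories are compared through integrals of nonnegative functions, by induction on the
  number of rounds.\<close>

locale query_rule =
  fixes q :: "nat \<Rightarrow> 'd::finite hist \<Rightarrow> (real ^ 'd) measure" and n :: nat
  assumes measurable_query: "t < n \<Longrightarrow> q t \<in> measurable (hist_space t) (prob_algebra borel)"
begin

text \<open>The expected number of the first \<open>t\<close> queries that fall in \<open>B\<close>:
  each round contributes the mean of the conditional probability of a hit given the past.\<close>

definition visits where
  "visits y K B t = (\<Sum>i<t. \<integral>\<^sup>+ h. emeasure (q i h) B \<partial>run y K q i)"

lemma prob_query:
  assumes "t < n" "h \<in> space (hist_space t)"
  shows "prob_space (q t h)" "sets (q t h) = sets borel" "space (q t h) = UNIV"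
  using measurable_space[OF measurable_query[OF assms(1)] assms(2)]
  by (auto simp: space_prob_algebra dest: sets_eq_imp_space_eq)

lemma measurable_query_emeasure:
  assumes "t < n" "B \<in> sets borel"
  shows "(\<lambda>h. emeasure (q t h) B) \<in> borel_measurable (hist_space t)"
  using measurable_prob_algebraD[OF measurable_query[OF assms(1)]] assms(2) by measurable

context
  fixes y :: "real ^ 'd \<Rightarrow> real" and K :: "real ^ 'd \<Rightarrow> real measure"
  assumes y: "y \<in> borel_measurable borel" and K: "K \<in> measurable borel (prob_algebra borel)"
begin

lemma measurable_step:
  assumes "t < n"
  shows "(\<lambda>h. q t h \<bind> (\<lambda>x. K x \<bind> (\<lambda>e. return (hist_space (Suc t)) (h(t := (x, y x + e))))))
    \<in> measurable (hist_space t) (prob_algebra (hist_space (Suc t)))"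
  by (rule measurable_bind_prob_space2[OF measurable_query[OF assms] measurable_observe[OF y K]])

lemma run_in_prob_algebra: "t \<le> n \<Longrightarrow> run y K q t \<in> space (prob_algebra (hist_space t))"
proof (induction t)
  case 0
  then show ?case
    by (auto simp: space_prob_algebra hist_space_def space_PiM intro!: prob_space_return)
next
  case (Suc t)
  then have R: "run y K q t \<in> space (prob_algebra (hist_space t))" and t: "t < n" by auto
  show ?case
    using prob_space_bind'[OF R measurable_step[OF t]] sets_bind'[OF R measurable_step[OF t]]
    by (simp add: space_prob_algebra)
qed

lemma
  assumes "t \<le> n"
  shows prob_space_run: "prob_space (run y K q t)"
    and sets_run: "sets (run y K q t) = sets (hist_space t)"
    and space_run: "space (run y K q t) = space (hist_space t)"
  using run_in_prob_algebra[OF assms] by (auto simp: space_prob_algebra dest: sets_eq_imp_space_eq)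

lemma nn_integral_step:
  assumes t: "t < n" and h: "h \<in> space (hist_space t)"
    and g: "g \<in> borel_measurable (hist_space (Suc t))"
  shows "(\<integral>\<^sup>+ h'. g h' \<partial>(q t h \<bind> (\<lambda>x. K x \<bind>
            (\<lambda>e. return (hist_space (Suc t)) (h(t := (x, y x + e)))))))
    = (\<integral>\<^sup>+ x. \<integral>\<^sup>+ e. g (h(t := (x, y x + e))) \<partial>K x \<partial>q t h)"
proof -
  have m: "(\<lambda>(x, e). h(t := (x, y x + e))) \<in> measurable (borel \<Otimes>\<^sub>M borel) (hist_space (Suc t))"
    using measurable_compose[OF _ measurable_history_upd[OF y, of t], of "\<lambda>(x, e). ((h, x), e)"
        "borel \<Otimes>\<^sub>M borel"] h by (simp add: case_prod_beta)
  have m1: "(\<lambda>e. h(t := (x, y x + e))) \<in> measurable borel (hist_space (Suc t))" for x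
    using measurable_compose[OF _ m, of "\<lambda>e. (x, e)" borel] by simp
  have o: "(\<lambda>x. K x \<bind> (\<lambda>e. return (hist_space (Suc t)) (h(t := (x, y x + e)))))
     \<in> measurable (q t h) (subprob_algebra (hist_space (Suc t)))"
    using measurable_compose[OF _ measurable_observe[OF y K, of t], of "\<lambda>x. (h, x)" borel] h
      measurable_cong_sets[OF prob_query(2)[OF t h] refl]
    by (auto intro: measurable_prob_algebraD)
  have setsK: "sets (K x) = sets borel" for x
    using measurable_space[OF K, of x] by (auto simp: space_prob_algebra)
  have inner: "(\<integral>\<^sup>+ h'. g h' \<partial>(K x \<bind> (\<lambda>e. return (hist_space (Suc t)) (h(t := (x, y x + e))))))
      = (\<integral>\<^sup>+ e. g (h(t := (x, y x + e))) \<partial>K x)" for x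
  proof -
    have "(\<lambda>e. return (hist_space (Suc t)) (h(t := (x, y x + e))))
        \<in> measurable (K x) (subprob_algebra (hist_space (Suc t)))"
      using measurable_compose[OF m1 return_measurable] measurable_cong_sets[OF setsK refl] by blast
    then have "(\<integral>\<^sup>+ h'. g h' \<partial>(K x \<bind> (\<lambda>e. return (hist_space (Suc t)) (h(t := (x, y x + e))))))
      = (\<integral>\<^sup>+ e. (\<integral>\<^sup>+ h'. g h' \<partial>return (hist_space (Suc t)) (h(t := (x, y x + e)))) \<partial>K x)"
      by (rule nn_integral_bind[OF g])
    also have "\<dots> = (\<integral>\<^sup>+ e. g (h(t := (x, y x + e))) \<partial>K x)"
      using measurable_space[OF m1, of _ x] by (intro nn_integral_cong nn_integral_return g) auto
    finally show ?thesis .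
  qed
  show ?thesis
    by (subst nn_integral_bind[OF g o]) (simp add: inner)
qed

text \<open>Peels off the last round, which turns a function of the longer history into a function
  of the shorter one. The inductions over rounds below rest on this.\<close>

lemma nn_integral_run_Suc:
  assumes t: "t < n" and g: "g \<in> borel_measurable (hist_space (Suc t))"
  shows "(\<integral>\<^sup>+ h. g h \<partial>run y K q (Suc t))
    = (\<integral>\<^sup>+ h. \<integral>\<^sup>+ x. \<integral>\<^sup>+ e. g (h(t := (x, y x + e))) \<partial>K x \<partial>q t h \<partial>run y K q t)"
proof -
  have tn: "t \<le> n" using t by simp
  have "(\<integral>\<^sup>+ h. g h \<partial>run y K q (Suc t)) = (\<integral>\<^sup>+ h. (\<integral>\<^sup>+ h'. g h' \<partial>(q t h \<bind> (\<lambda>x. K x \<bind>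
            (\<lambda>e. return (hist_space (Suc t)) (h(t := (x, y x + e))))))) \<partial>run y K q t)"
    unfolding run.simps
    using measurable_prob_algebraD[OF measurable_step[OF t]] measurable_cong_sets[OF sets_run[OF tn] refl]
    by (intro nn_integral_bind[OF g]) auto
  also have "\<dots> = (\<integral>\<^sup>+ h. \<integral>\<^sup>+ x. \<integral>\<^sup>+ e. g (h(t := (x, y x + e))) \<partial>K x \<partial>q t h \<partial>run y K q t)"
    by (intro nn_integral_cong nn_integral_step[OF t _ g]) (simp add: space_run[OF tn])
  finally show ?thesis .
qed

lemma measurable_query_point_integral:
  assumes g: "g \<in> borel_measurable (hist_space (Suc t))" and h: "h \<in> space (hist_space t)"
  shows "(\<lambda>x. \<integral>\<^sup>+ e. g (h(t := (x, y x + e))) \<partial>K x) \<in> borel_measurable borel"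
proof -
  have "(\<lambda>(x, e). h(t := (x, y x + e))) \<in> measurable (borel \<Otimes>\<^sub>M borel) (hist_space (Suc t))"
    using measurable_compose[OF _ measurable_history_upd[OF y, of t], of "\<lambda>(x, e). ((h, x), e)"
        "borel \<Otimes>\<^sub>M borel"] h by (simp add: case_prod_beta)
  from measurable_compose[OF this g]
  have "(\<lambda>(x, e). g (h(t := (x, y x + e)))) \<in> borel_measurable (borel \<Otimes>\<^sub>M borel)"
    by (simp add: case_prod_beta)
  then show ?thesis
    by (rule nn_integral_measurable_subprob_algebra2[OF _ measurable_prob_algebraD[OF K]])
qed

text \<open>The iterated integral is an integral against the one-round kernel of
  \<open>measurable_step\<close>, and in that form it is visibly measurable in
  \<open>h\<close>.\<close>

lemma measurable_history_integral:
  assumes g: "g \<in> borel_measurable (hist_space (Suc t))" and t: "t < n"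
  shows "(\<lambda>h. \<integral>\<^sup>+ x. \<integral>\<^sup>+ e. g (h(t := (x, y x + e))) \<partial>K x \<partial>q t h) \<in> borel_measurable (hist_space t)"
proof -
  have "(\<lambda>h. \<integral>\<^sup>+ h'. g h' \<partial>(q t h \<bind> (\<lambda>x. K x \<bind>
            (\<lambda>e. return (hist_space (Suc t)) (h(t := (x, y x + e))))))) \<in> borel_measurable (hist_space t)"
    by (rule measurable_compose[OF measurable_prob_algebraD[OF measurable_step[OF t]]
          nn_integral_measurable_subprob_algebra[OF g]])
  then show ?thesis
    by (subst (asm) measurable_cong[OF nn_integral_step[OF t _ g]]) auto
qed

end
end

section \<open>Change of problem\<close>

text \<open>Equivalently \<open>8/3 \<le> 3 * exp s - 2 * s\<close>. The right side is least at
  \<open>exp s = 2/3\<close>, so the tangent there suffices, together with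
  \<open>ln (2/3) \<le> - 1/3\<close>.\<close>

lemma excess_exp_lower: "1 \<le> exp s + 1/3 + 2 * (exp s - 1 - s)" for s :: real
proof -
  have "1 - 2/3 \<le> - ln (2/3 :: real)" using ln_le_minus_one[of "2/3::real"] by simp
  moreover have "1 + (s - ln (2/3)) \<le> exp (s - ln (2/3))" by (rule exp_ge_add_one_self)
  moreover have "exp (s - ln (2/3)) = exp s * (3/2)" by (simp add: exp_diff)
  ultimately show ?thesis by (simp add: field_simps)
qed

text \<open>With \<open>s\<close> the log-likelihood ratio of two laws, \<open>exp s - 1 - s\<close> integrates under the first law to
  their divergence and, unlike \<open>-s\<close>, is nonnegative, so that Lebesgue integrals suffice. The summand
  \<open>1/3\<close> comes from the tangent of the exponential at \<open>s = ln (2/3)\<close>.\<close>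
lemma truncated_change_of_measure:
  fixes s \<gamma> :: real
  assumes "0 \<le> \<gamma>" "\<gamma> \<le> 1"
  shows "\<gamma> \<le> \<gamma> * exp s + 1/3 + 2 * (exp s - 1 - s)"
proof (cases "exp s \<ge> 1")
  case True
  then have "\<gamma> \<le> \<gamma> * exp s" using assms mult_left_mono[of 1 "exp s" \<gamma>] by simp
  moreover have "0 \<le> exp s - 1 - s" using exp_ge_add_one_self[of s] by linarith
  ultimately show ?thesis by argo
next
  case False
  \<comment> \<open>For \<open>exp s < 1\<close> the loss \<open>\<gamma> * (1 - exp s)\<close> is
    largest at \<open>\<gamma> = 1\<close>, the case of \<open>excess_exp_lower\<close>.\<close>
  then have "\<gamma> * (1 - exp s) \<le> 1 * (1 - exp s)" using assms by (intro mult_right_mono) auto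
  with excess_exp_lower[of s] show ?thesis by (simp add: algebra_simps)
qed

text \<open>Only the observations contribute: both problems are run with the same query rule, whose
  kernels cancel in the likelihood ratio.\<close>

definition loglik :: "((real ^ 'd::finite) \<times> real \<Rightarrow> real) \<Rightarrow> nat \<Rightarrow> 'd hist \<Rightarrow> real" where
  "loglik l t h = (\<Sum>i<t. l (h i))"

lemma loglik_upd: "loglik l (Suc t) (h(t := z)) = loglik l t h + l z"
  by (auto simp: loglik_def)

lemma measurable_loglik:
  fixes l :: "(real ^ 'd::finite) \<times> real \<Rightarrow> real"
  assumes [measurable]: "l \<in> borel_measurable borel"
  shows "loglik l t \<in> borel_measurable (hist_space t)"
  unfolding loglik_def hist_space_def by measurable

context query_rule
begin

lemma visits_Suc: "visits y K B (Suc t) = visits y K B t + (\<integral>\<^sup>+ h. emeasure (q t h) B \<partial>run y K q t)"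
  by (simp add: visits_def)

text \<open>Noiseless histories agree until \<open>B\<close> is first visited, and the probability
  of a visit is at most the expected number of visits. In place of a coupling, the induction
  exchanges \<open>y0\<close> for \<open>y1\<close> round by round, for arbitrary test functions
  bounded by 1.\<close>

lemma noiseless_change_of_problem:
  fixes y0 y1 :: "real ^ 'd \<Rightarrow> real"
  defines "K \<equiv> \<lambda>_. return borel (0::real)"
  assumes y0: "y0 \<in> borel_measurable borel" and y1: "y1 \<in> borel_measurable borel"
    and B: "B \<in> sets borel" and eq: "\<And>x. x \<notin> B \<Longrightarrow> y1 x = y0 x"
    and g: "g \<in> borel_measurable (hist_space t)" "\<And>h. g h \<le> (1::ennreal)" and t: "t \<le> n"
  shows "(\<integral>\<^sup>+ h. g h \<partial>run y0 K q t) \<le> (\<integral>\<^sup>+ h. g h \<partial>run y1 K q t) + visits y0 K B t"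
  using g t
proof (induction t arbitrary: g)
  case 0
  then show ?case by (simp add: visits_def)
next
  case (Suc t)
  have K: "K \<in> measurable borel (prob_algebra borel)"
    unfolding K_def by (intro measurable_const) (auto simp: space_prob_algebra prob_space_return)
  let ?G = "\<lambda>y h. \<integral>\<^sup>+ x. \<integral>\<^sup>+ e. g (h(t := (x, y x + e))) \<partial>K x \<partial>q t h"
  have t: "t < n" "t \<le> n" using Suc.prems by auto
  have meas_inner: "(\<lambda>e. g (h(t := (x, y x + e)))) \<in> borel_measurable borel"
    if "h \<in> space (hist_space t)" "y \<in> borel_measurable borel" for h x and y :: "real ^ 'd \<Rightarrow> real"
    using measurable_compose[OF _ measurable_compose[OF measurable_history_upd[OF that(2), of t] Suc.prems(1)],
        of "\<lambda>e. ((h, x), e)" borel] that by (simp add: fun_upd_def)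
  have inner: "(\<integral>\<^sup>+ e. g (h(t := (x, y x + e))) \<partial>K x) = g (h(t := (x, y x)))"
    if "h \<in> space (hist_space t)" "y \<in> borel_measurable borel" for h x and y :: "real ^ 'd \<Rightarrow> real"
    unfolding K_def by (subst nn_integral_return[OF _ meas_inner[OF that]]) auto
  have G1: "?G y h \<le> 1" if "h \<in> space (hist_space t)" "y \<in> borel_measurable borel" for h y
  proof -
    interpret prob_space "q t h" by (rule prob_query(1)[OF t(1) that(1)])
    have "?G y h \<le> (\<integral>\<^sup>+ x. 1 \<partial>q t h)"
      by (intro nn_integral_mono) (simp add: inner[OF that] Suc.prems)
    then show ?thesis by (simp add: emeasure_space_1)
  qed
  have le: "?G y0 h \<le> ?G y1 h + emeasure (q t h) B" if h: "h \<in> space (hist_space t)" for h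
  proof -
    have sq: "sets (q t h) = sets borel" by (rule prob_query(2)[OF t(1) h])
    \<comment> \<open>Off \<open>B\<close> the integrands agree; on \<open>B\<close> the indicator
      pays for \<open>g \<le> 1\<close>.\<close>
    have "?G y0 h \<le> (\<integral>\<^sup>+ x. (\<integral>\<^sup>+ e. g (h(t := (x, y1 x + e))) \<partial>K x) + indicator B x \<partial>q t h)"
      using eq Suc.prems(2)
      by (intro nn_integral_mono) (auto simp: inner[OF h y0] inner[OF h y1] split: split_indicator
          intro: add_increasing)
    also have "\<dots> = ?G y1 h + emeasure (q t h) B"
      using measurable_query_point_integral[OF y1 K Suc.prems(1) h] sq B
      by (subst nn_integral_add) (auto simp: measurable_cong_sets[OF sq refl] fun_upd_def)
    finally show ?thesis .
  qed
  \<comment> \<open>\<open>?G\<close> is bounded by 1 on the history space only, hence the truncation.\<close>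
  let ?G' = "\<lambda>y h. min 1 (?G y h)"
  have "(\<integral>\<^sup>+ h. g h \<partial>run y0 K q (Suc t)) = (\<integral>\<^sup>+ h. ?G y0 h \<partial>run y0 K q t)"
    by (rule nn_integral_run_Suc[OF y0 K t(1) Suc.prems(1)])
  also have "\<dots> \<le> (\<integral>\<^sup>+ h. ?G' y1 h + emeasure (q t h) B \<partial>run y0 K q t)"
    using le G1[OF _ y1] by (intro nn_integral_mono) (simp add: space_run[OF y0 K t(2)] min_absorb2)
  also have "\<dots> = (\<integral>\<^sup>+ h. ?G' y1 h \<partial>run y0 K q t) + (\<integral>\<^sup>+ h. emeasure (q t h) B \<partial>run y0 K q t)"
    by (intro nn_integral_add; unfold measurable_cong_sets[OF sets_run[OF y0 K t(2)] refl])
       (intro borel_measurable_min borel_measurable_const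
         measurable_history_integral[OF y1 K Suc.prems(1) t(1)] measurable_query_emeasure[OF t(1) B])+
  \<comment> \<open>The last round already runs on \<open>y1\<close>. The induction hypothesis, with
    the truncated conditional integral as test function, moves the first \<open>t\<close>
    rounds.\<close>
  also have "(\<integral>\<^sup>+ h. ?G' y1 h \<partial>run y0 K q t) \<le> (\<integral>\<^sup>+ h. ?G' y1 h \<partial>run y1 K q t) + visits y0 K B t"
    by (intro Suc.IH t borel_measurable_min borel_measurable_const
        measurable_history_integral[OF y1 K Suc.prems(1) t(1)]) simp
  also have "(\<integral>\<^sup>+ h. ?G' y1 h \<partial>run y1 K q t) = (\<integral>\<^sup>+ h. ?G y1 h \<partial>run y1 K q t)"
    using G1[OF _ y1] by (intro nn_integral_cong) (simp add: space_run[OF y1 K t(2)] min_absorb2)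
  also have "\<dots> = (\<integral>\<^sup>+ h. g h \<partial>run y1 K q (Suc t))"
    by (rule nn_integral_run_Suc[OF y1 K t(1) Suc.prems(1), symmetric])
  finally show ?case by (simp add: visits_Suc add_ac add_mono)
qed

text \<open>Both problems share the noise kernel. By \<open>ratio\<close>, the observation at
  \<open>x\<close> under \<open>y1\<close> has density \<open>exp (l (x, Y))\<close> relative to the
  one under \<open>y0\<close>; stating this through integrals avoids a reference measure.\<close>

context
  fixes y0 y1 :: "real ^ 'd \<Rightarrow> real" and K :: "real ^ 'd \<Rightarrow> real measure"
    and l :: "(real ^ 'd) \<times> real \<Rightarrow> real"
  assumes y0: "y0 \<in> borel_measurable borel" and y1: "y1 \<in> borel_measurable borel"
    and K: "K \<in> measurable borel (prob_algebra borel)"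
    and l: "l \<in> borel_measurable borel"
    and ratio: "\<And>x (u :: real \<Rightarrow> ennreal). u \<in> borel_measurable borel \<Longrightarrow>
      (\<integral>\<^sup>+ e. u (y1 x + e) \<partial>K x) = (\<integral>\<^sup>+ e. u (y0 x + e) * ennreal (exp (l (x, y0 x + e))) \<partial>K x)"
begin

text \<open>Likelihood ratios multiply along the rounds: the induction hypothesis reweights the
  first \<open>t\<close> rounds, and \<open>ratio\<close> the last one inside the conditional
  integral.\<close>

lemma nn_integral_likelihood:
  assumes "g \<in> borel_measurable (hist_space t)" and "t \<le> n"
  shows "(\<integral>\<^sup>+ h. g h \<partial>run y1 K q t) = (\<integral>\<^sup>+ h. g h * ennreal (exp (loglik l t h)) \<partial>run y0 K q t)"
  using assms
proof (induction t arbitrary: g)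
  case 0
  then show ?case by (simp add: loglik_def)
next
  case (Suc t)
  note g = Suc.prems(1)
  have t: "t < n" "t \<le> n" using Suc.prems by auto
  let ?G = "\<lambda>h. \<integral>\<^sup>+ x. \<integral>\<^sup>+ e. g (h(t := (x, y1 x + e))) \<partial>K x \<partial>q t h"
  let ?g = "\<lambda>h. g h * ennreal (exp (loglik l (Suc t) h))"
  have g': "?g \<in> borel_measurable (hist_space (Suc t))"
    using g measurable_loglik[OF l, of "Suc t"] by measurable
  have setsK: "sets (K x) = sets borel" for x
    using measurable_space[OF K, of x] by (auto simp: space_prob_algebra)
  have step: "?G h * ennreal (exp (loglik l t h))
      = (\<integral>\<^sup>+ x. \<integral>\<^sup>+ e. ?g (h(t := (x, y0 x + e))) \<partial>K x \<partial>q t h)" if h: "h \<in> space (hist_space t)" for h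
  proof -
    have sq: "sets (q t h) = sets borel" by (rule prob_query(2)[OF t(1) h])
    \<comment> \<open>With the zero objective the observation equals the noise, so the update lemma
      yields measurability in the observed value itself.\<close>
    have mu: "(\<lambda>Y. g (h(t := (x, Y)))) \<in> borel_measurable borel" for x
      using measurable_compose[OF _ measurable_compose[OF measurable_history_upd[of "\<lambda>_. 0" t] g],
          of "\<lambda>e. ((h, x), e)" borel] h by (simp add: fun_upd_def)
    have ml: "(\<lambda>Y. l (x, Y)) \<in> borel_measurable borel" for x
      using measurable_compose[OF _ l, of "\<lambda>Y. (x, Y)" borel] by (simp add: borel_prod[symmetric])
    have pt: "(\<integral>\<^sup>+ e. g (h(t := (x, y1 x + e))) \<partial>K x) * ennreal (exp (loglik l t h))
        = (\<integral>\<^sup>+ e. ?g (h(t := (x, y0 x + e))) \<partial>K x)" for x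
    proof -
      have "(\<lambda>e. g (h(t := (x, y0 x + e)))) \<in> borel_measurable borel"
        by (rule measurable_compose[OF _ mu]) simp
      moreover have "(\<lambda>e. l (x, y0 x + e)) \<in> borel_measurable borel"
        by (rule measurable_compose[OF _ ml]) simp
      ultimately have "(\<lambda>e. g (h(t := (x, y0 x + e))) * ennreal (exp (l (x, y0 x + e)))) \<in> borel_measurable (K x)"
        unfolding measurable_cong_sets[OF setsK refl] by measurable
      from nn_integral_multc[OF this, of "ennreal (exp (loglik l t h))"] show ?thesis
        by (subst ratio[OF mu]) (simp add: loglik_upd exp_add ennreal_mult mult_ac)
    qed
    show ?thesis
      by (subst nn_integral_multc[symmetric])
         (simp_all only: measurable_cong_sets[OF sq refl] pt measurable_query_point_integral[OF y1 K g h])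
  qed
  have "(\<integral>\<^sup>+ h. g h \<partial>run y1 K q (Suc t)) = (\<integral>\<^sup>+ h. ?G h \<partial>run y1 K q t)"
    by (rule nn_integral_run_Suc[OF y1 K t(1) g])
  also have "\<dots> = (\<integral>\<^sup>+ h. ?G h * ennreal (exp (loglik l t h)) \<partial>run y0 K q t)"
    by (rule Suc.IH[OF measurable_history_integral[OF y1 K g t(1)] t(2)])
  also have "\<dots> = (\<integral>\<^sup>+ h. \<integral>\<^sup>+ x. \<integral>\<^sup>+ e. ?g (h(t := (x, y0 x + e))) \<partial>K x \<partial>q t h \<partial>run y0 K q t)"
    by (intro nn_integral_cong step) (simp add: space_run[OF y0 K t(2)])
  also have "\<dots> = (\<integral>\<^sup>+ h. ?g h \<partial>run y0 K q (Suc t))"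
    by (rule nn_integral_run_Suc[OF y0 K t(1) g', symmetric])
  finally show ?case .
qed

text \<open>\<open>s\<close> is the log-likelihood ratio accumulated so far. One more observation
  may raise the mean of the excess \<open>exp s - 1 - s\<close> by at most \<open>c\<close>, and
  only if the query lies in \<open>B\<close>.\<close>

context
  fixes B :: "(real ^ 'd) set" and c :: ennreal
  assumes B: "B \<in> sets borel"
    and divergence: "\<And>x s. (\<integral>\<^sup>+ e. ennreal (exp (s + l (x, y0 x + e)) - 1 - (s + l (x, y0 x + e))) \<partial>K x)
      \<le> ennreal (exp s - 1 - s) + c * indicator B x"
begin

text \<open>A chain rule for the divergence: each round adds at most \<open>c\<close> times the
  probability of querying \<open>B\<close>.\<close>

lemma nn_integral_excess_loglik:
  assumes "t \<le> n"
  shows "(\<integral>\<^sup>+ h. ennreal (exp (loglik l t h) - 1 - loglik l t h) \<partial>run y0 K q t) \<le> c * visits y0 K B t"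
  using assms
proof (induction t)
  case 0
  then show ?case by (simp add: loglik_def)
next
  case (Suc t)
  let ?\<phi> = "\<lambda>t h. ennreal (exp (loglik l t h) - 1 - loglik l t h)"
  have t: "t < n" "t \<le> n" using Suc.prems by auto
  have m: "?\<phi> t \<in> borel_measurable (hist_space t)" for t
    using measurable_loglik[OF l, of t] by measurable
  have step: "(\<integral>\<^sup>+ x. \<integral>\<^sup>+ e. ?\<phi> (Suc t) (h(t := (x, y0 x + e))) \<partial>K x \<partial>q t h)
      \<le> ?\<phi> t h + c * emeasure (q t h) B" if h: "h \<in> space (hist_space t)" for h
  proof -
    interpret prob_space "q t h" by (rule prob_query(1)[OF t(1) h])
    have sq: "sets (q t h) = sets borel" by (rule prob_query(2)[OF t(1) h])
    have "(\<integral>\<^sup>+ x. \<integral>\<^sup>+ e. ?\<phi> (Suc t) (h(t := (x, y0 x + e))) \<partial>K x \<partial>q t h)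
        \<le> (\<integral>\<^sup>+ x. ?\<phi> t h + c * indicator B x \<partial>q t h)"
      by (intro nn_integral_mono) (simp only: loglik_upd divergence)
    also have "\<dots> = ?\<phi> t h + c * emeasure (q t h) B"
      using sq B by (subst nn_integral_add) (auto simp: emeasure_space_1 nn_integral_cmult_indicator)
    finally show ?thesis .
  qed
  have "(\<integral>\<^sup>+ h. ?\<phi> (Suc t) h \<partial>run y0 K q (Suc t))
      \<le> (\<integral>\<^sup>+ h. ?\<phi> t h + c * emeasure (q t h) B \<partial>run y0 K q t)"
    unfolding nn_integral_run_Suc[OF y0 K t(1) m]
    by (intro nn_integral_mono step) (simp add: space_run[OF y0 K t(2)])
  also have "\<dots> = (\<integral>\<^sup>+ h. ?\<phi> t h \<partial>run y0 K q t) + c * (\<integral>\<^sup>+ h. emeasure (q t h) B \<partial>run y0 K q t)"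
  proof -
    have [measurable]: "(\<lambda>h. emeasure (q t h) B) \<in> borel_measurable (run y0 K q t)"
      "?\<phi> t \<in> borel_measurable (run y0 K q t)"
      using m measurable_query_emeasure[OF t(1) B]
      by (auto simp: measurable_cong_sets[OF sets_run[OF y0 K t(2)] refl])
    show ?thesis by (subst nn_integral_add) (auto simp: nn_integral_cmult)
  qed
  also have "\<dots> \<le> c * visits y0 K B (Suc t)"
    using Suc.IH[OF t(2)] by (simp add: visits_Suc distrib_left add_mono)
  finally show ?case .
qed

text \<open>The bound \<open>truncated_change_of_measure\<close>, with \<open>\<gamma> = g h\<close>
  and \<open>s\<close> the log-likelihood ratio, is integrated under \<open>y0\<close>. Its first
  term becomes an integral under \<open>y1\<close>, its last one the divergence.\<close>

lemma noisy_change_of_problem: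
  assumes g: "g \<in> borel_measurable (hist_space t)" "\<And>h. g h \<le> (1::ennreal)" and t: "t \<le> n"
  shows "(\<integral>\<^sup>+ h. g h \<partial>run y0 K q t) \<le> (\<integral>\<^sup>+ h. g h \<partial>run y1 K q t) + ennreal (1/3) + 2 * c * visits y0 K B t"
proof -
  interpret prob_space "run y0 K q t" by (rule prob_space_run[OF y0 K t])
  let ?L = "\<lambda>h. ennreal (exp (loglik l t h))"
  let ?\<phi> = "\<lambda>h. ennreal (exp (loglik l t h) - 1 - loglik l t h)"
  have [measurable]: "loglik l t \<in> borel_measurable (run y0 K q t)" "g \<in> borel_measurable (run y0 K q t)"
    using measurable_loglik[OF l, of t] g(1) by (auto simp: measurable_cong_sets[OF sets_run[OF y0 K t] refl])
  have "g h \<le> g h * ?L h + ennreal (1/3) + 2 * ?\<phi> h" for h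
  proof -
    have top: "g h \<noteq> \<top>" using g(2)[of h] by (metis ennreal_one_neq_top top.extremum_uniqueI)
    define \<gamma> where "\<gamma> = enn2real (g h)"
    have \<gamma>: "g h = ennreal \<gamma>" "0 \<le> \<gamma>" "\<gamma> \<le> 1"
      using g(2)[of h] top by (auto simp: \<gamma>_def enn2real_leI less_top)
    have sum: "ennreal (a + b + 2 * d) = ennreal a + ennreal b + 2 * ennreal d"
      if "0 \<le> a" "0 \<le> b" "0 \<le> d" for a b d
      using that by (simp add: ennreal_mult)
    have "0 \<le> exp (loglik l t h) - 1 - loglik l t h" using exp_ge_add_one_self[of "loglik l t h"] by linarith
    then have "ennreal (\<gamma> * exp (loglik l t h) + 1/3 + 2 * (exp (loglik l t h) - 1 - loglik l t h))
       = g h * ?L h + ennreal (1/3) + 2 * ?\<phi> h"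
      using \<gamma> by (subst sum) (auto simp: ennreal_mult)
    then show ?thesis
      using ennreal_leI[OF truncated_change_of_measure[OF \<gamma>(2,3), of "loglik l t h"]] \<gamma>(1) by metis
  qed
  then have "(\<integral>\<^sup>+ h. g h \<partial>run y0 K q t) \<le> (\<integral>\<^sup>+ h. g h * ?L h + ennreal (1/3) + 2 * ?\<phi> h \<partial>run y0 K q t)"
    by (intro nn_integral_mono) auto
  also have "\<dots> = (\<integral>\<^sup>+ h. g h * ?L h \<partial>run y0 K q t) + ennreal (1/3) + 2 * (\<integral>\<^sup>+ h. ?\<phi> h \<partial>run y0 K q t)"
    by (simp add: nn_integral_add nn_integral_cmult emeasure_space_1)
  also have "\<dots> \<le> (\<integral>\<^sup>+ h. g h \<partial>run y1 K q t) + ennreal (1/3) + 2 * (c * visits y0 K B t)"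
    by (intro add_mono mult_left_mono nn_integral_excess_loglik t)
       (simp_all add: nn_integral_likelihood[OF g(1) t])
  finally show ?thesis by (simp add: mult_ac)
qed

end
end
end

section \<open>Gaussian noise\<close>

definition gauss :: "real \<Rightarrow> real measure" where
  "gauss \<sigma> = density lborel (\<lambda>e. ennreal (normal_density 0 \<sigma> e))"

text \<open>Completing the square: a tilt with parameter \<open>a\<close> moves the mean to
  \<open>a * \<sigma>\<^sup>2\<close>. The moment generating function and the likelihood ratios
  below both come from this.\<close>

lemma exponential_tilt_normal_density:
  assumes "\<sigma> > 0"
  shows "normal_density 0 \<sigma> e * exp (a * e - a\<^sup>2 * \<sigma>\<^sup>2 / 2) = normal_density (a * \<sigma>\<^sup>2) \<sigma> e"
proof -
  have "- e\<^sup>2 / (2 * \<sigma>\<^sup>2) + (a * e - a\<^sup>2 * \<sigma>\<^sup>2 / 2) = - (e - a * \<sigma>\<^sup>2)\<^sup>2 / (2 * \<sigma>\<^sup>2)"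
    using assms by (simp add: field_simps power2_eq_square)
  then show ?thesis
    by (simp add: normal_density_def flip: exp_add)
qed

lemma gauss_in_prob_algebra:
  assumes "\<sigma> > 0"
  shows "gauss \<sigma> \<in> space (prob_algebra borel)"
  using prob_space_normal_density[OF assms, of 0] by (simp add: space_prob_algebra gauss_def)

lemma has_bochner_integral_gauss_tilt:
  assumes "\<sigma> > 0"
  shows "has_bochner_integral (gauss \<sigma>) (\<lambda>e. exp (a * e - a\<^sup>2 * \<sigma>\<^sup>2 / 2)) 1"
proof -
  have "has_bochner_integral lborel (normal_density (a * \<sigma>\<^sup>2) \<sigma>) 1"
    using assms by (simp add: has_bochner_integral_iff)
  then have "has_bochner_integral lborel
      (\<lambda>e. normal_density 0 \<sigma> e *\<^sub>R exp (a * e - a\<^sup>2 * \<sigma>\<^sup>2 / 2)) 1"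
    by (simp add: exponential_tilt_normal_density[OF assms])
  then show ?thesis
    unfolding gauss_def by (intro has_bochner_integral_density) auto
qed

lemma has_bochner_integral_gauss_exp:
  assumes "\<sigma> > 0"
  shows "has_bochner_integral (gauss \<sigma>) (\<lambda>e. exp (a * e)) (exp (a\<^sup>2 * \<sigma>\<^sup>2 / 2))"
  using has_bochner_integral_mult_right[OF has_bochner_integral_gauss_tilt[OF assms, of a],
      of "exp (a\<^sup>2 * \<sigma>\<^sup>2 / 2)"]
  by (simp flip: exp_add)

lemma has_bochner_integral_gauss_id:
  assumes "\<sigma> > 0"
  shows "has_bochner_integral (gauss \<sigma>) (\<lambda>e. e) 0"
  using normal_moment_nz_1[OF assms, of 0]
  unfolding gauss_def by (intro has_bochner_integral_density) auto

text \<open>The exponential factor is the density of the normal law with mean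
  \<open>\<Delta>\<close> relative to the centred one: the tilt with
  \<open>a = \<Delta> / \<sigma>\<^sup>2\<close>.\<close>

lemma nn_integral_gauss_shift:
  assumes \<sigma>: "\<sigma> > 0" and u[measurable]: "u \<in> borel_measurable borel"
  shows "(\<integral>\<^sup>+ e. u (\<Delta> + e) \<partial>gauss \<sigma>)
    = (\<integral>\<^sup>+ e. u e * ennreal (exp ((\<Delta> * e - \<Delta>\<^sup>2 / 2) / \<sigma>\<^sup>2)) \<partial>gauss \<sigma>)"
proof -
  have "normal_density 0 \<sigma> (e - \<Delta>) = normal_density 0 \<sigma> e * exp ((\<Delta> * e - \<Delta>\<^sup>2 / 2) / \<sigma>\<^sup>2)" for e
  proof -
    have "normal_density 0 \<sigma> (e - \<Delta>) = normal_density (\<Delta> / \<sigma>\<^sup>2 * \<sigma>\<^sup>2) \<sigma> e"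
      using \<sigma> by (simp add: normal_density_def)
    also have "\<dots> = normal_density 0 \<sigma> e * exp (\<Delta> / \<sigma>\<^sup>2 * e - (\<Delta> / \<sigma>\<^sup>2)\<^sup>2 * \<sigma>\<^sup>2 / 2)"
      by (rule exponential_tilt_normal_density[OF \<sigma>, symmetric])
    also have "\<Delta> / \<sigma>\<^sup>2 * e - (\<Delta> / \<sigma>\<^sup>2)\<^sup>2 * \<sigma>\<^sup>2 / 2 = (\<Delta> * e - \<Delta>\<^sup>2 / 2) / \<sigma>\<^sup>2"
      using \<sigma> by (simp add: field_simps power2_eq_square)
    finally show ?thesis .
  qed
  note shift = this
  \<comment> \<open>The factor 1 and the difference \<open>\<Delta> + 1 * e - \<Delta>\<close> give
    the integrand the shape required for an affine substitution.\<close>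
  have "(\<integral>\<^sup>+ e. u (\<Delta> + e) \<partial>gauss \<sigma>) = (\<integral>\<^sup>+ e. normal_density 0 \<sigma> (\<Delta> + 1 * e - \<Delta>) * u (\<Delta> + 1 * e) \<partial>lborel)"
    by (simp add: gauss_def nn_integral_density)
  also have "\<dots> = (\<integral>\<^sup>+ e. normal_density 0 \<sigma> (e - \<Delta>) * u e \<partial>lborel)"
    using nn_integral_real_affine[where c = 1 and t = \<Delta>
        and f = "\<lambda>e. ennreal (normal_density 0 \<sigma> (e - \<Delta>)) * u e"] by simp
  also have "\<dots> = (\<integral>\<^sup>+ e. u e * ennreal (exp ((\<Delta> * e - \<Delta>\<^sup>2 / 2) / \<sigma>\<^sup>2)) \<partial>gauss \<sigma>)"
    by (simp add: shift gauss_def nn_integral_density ennreal_mult mult_ac)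
  finally show ?thesis .
qed

text \<open>The tilt has mean 1, which preserves \<open>exp s\<close>, and the added exponent has
  mean \<open>- \<Delta>\<^sup>2 / (2 * \<sigma>\<^sup>2)\<close>. The increase is thus exactly the
  divergence of two normal laws whose means differ by \<open>\<Delta>\<close>.\<close>

lemma nn_integral_gauss_excess:
  assumes \<sigma>: "\<sigma> > 0"
  shows "(\<integral>\<^sup>+ e. ennreal (exp (s + (\<Delta> * e - \<Delta>\<^sup>2 / 2) / \<sigma>\<^sup>2) - 1 - (s + (\<Delta> * e - \<Delta>\<^sup>2 / 2) / \<sigma>\<^sup>2)) \<partial>gauss \<sigma>)
    = ennreal (exp s - 1 - s + \<Delta>\<^sup>2 / (2 * \<sigma>\<^sup>2))"
proof -
  interpret prob_space "gauss \<sigma>" using gauss_in_prob_algebra[OF \<sigma>] by (simp add: space_prob_algebra)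
  define a where "a = \<Delta> / \<sigma>\<^sup>2"
  have a: "(\<Delta> * e - \<Delta>\<^sup>2 / 2) / \<sigma>\<^sup>2 = a * e - a\<^sup>2 * \<sigma>\<^sup>2 / 2" for e
    using \<sigma> by (simp add: a_def field_simps power2_eq_square)
  have a2: "\<Delta>\<^sup>2 / (2 * \<sigma>\<^sup>2) = a\<^sup>2 * \<sigma>\<^sup>2 / 2"
    using \<sigma> by (simp add: a_def field_simps power2_eq_square)
  have const: "has_bochner_integral (gauss \<sigma>) (\<lambda>e. c) c" for c :: real
    by (simp add: has_bochner_integral_iff prob_space)
  have "has_bochner_integral (gauss \<sigma>)
      (\<lambda>e. exp s * exp (a * e - a\<^sup>2 * \<sigma>\<^sup>2 / 2) + ((a\<^sup>2 * \<sigma>\<^sup>2 / 2 - 1 - s) - a * e))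
      (exp s * 1 + ((a\<^sup>2 * \<sigma>\<^sup>2 / 2 - 1 - s) - a * 0))"
    by (intro has_bochner_integral_add has_bochner_integral_diff has_bochner_integral_mult_right const
        has_bochner_integral_gauss_tilt has_bochner_integral_gauss_id \<sigma>)
  then have "has_bochner_integral (gauss \<sigma>)
      (\<lambda>e. exp (s + (a * e - a\<^sup>2 * \<sigma>\<^sup>2 / 2)) - 1 - (s + (a * e - a\<^sup>2 * \<sigma>\<^sup>2 / 2)))
      (exp s - 1 - s + a\<^sup>2 * \<sigma>\<^sup>2 / 2)"
    by (subst exp_add) (simp add: algebra_simps)
  moreover have "0 \<le> exp z - 1 - z" for z :: real using exp_ge_add_one_self[of z] by linarith
  ultimately show ?thesis
    unfolding a a2 by (auto simp: nn_integral_eq_integral has_bochner_integral_iff)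
qed

text \<open>A query in \<open>B\<close> costs divergence at most
  \<open>(\<delta> / \<sigma>)\<^sup>2 / 2\<close>; the factor 2 in
  \<open>noisy_change_of_problem\<close> cancels the 1/2.\<close>

lemma (in query_rule) gaussian_change_of_problem:
  fixes y0 y1 :: "real ^ 'd \<Rightarrow> real"
  assumes y0: "y0 \<in> borel_measurable borel" and y1: "y1 \<in> borel_measurable borel"
    and B: "B \<in> sets borel" and eq: "\<And>x. x \<notin> B \<Longrightarrow> y1 x = y0 x"
    and \<delta>: "\<And>x. \<bar>y1 x - y0 x\<bar> \<le> \<delta>" and \<sigma>: "\<sigma> > 0"
    and g: "g \<in> borel_measurable (hist_space t)" "\<And>h. g h \<le> (1::ennreal)" and t: "t \<le> n"
  shows "(\<integral>\<^sup>+ h. g h \<partial>run y0 (\<lambda>_. gauss \<sigma>) q t)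
    \<le> (\<integral>\<^sup>+ h. g h \<partial>run y1 (\<lambda>_. gauss \<sigma>) q t) + ennreal (1/3)
      + ennreal ((\<delta> / \<sigma>)\<^sup>2) * visits y0 (\<lambda>_. gauss \<sigma>) B t"
proof -
  \<comment> \<open>The log-likelihood ratio of one observation \<open>Y\<close>, whose noise under
    \<open>y0\<close> is \<open>Y - y0 x\<close>. It vanishes where the objectives agree.\<close>
  define l :: "(real ^ 'd) \<times> real \<Rightarrow> real" where
    "l = (\<lambda>(x, Y). ((y1 x - y0 x) * (Y - y0 x) - (y1 x - y0 x)\<^sup>2 / 2) / \<sigma>\<^sup>2)"
  have K: "(\<lambda>_. gauss \<sigma>) \<in> measurable borel (prob_algebra borel)"
    using gauss_in_prob_algebra[OF \<sigma>] by (intro measurable_const)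
  have l: "l \<in> borel_measurable borel"
    unfolding l_def borel_prod[symmetric] using y0 y1 by measurable
  have ratio: "(\<integral>\<^sup>+ e. u (y1 x + e) \<partial>gauss \<sigma>) = (\<integral>\<^sup>+ e. u (y0 x + e) * ennreal (exp (l (x, y0 x + e))) \<partial>gauss \<sigma>)"
    if [measurable]: "u \<in> borel_measurable borel" for u :: "real \<Rightarrow> ennreal" and x
    using nn_integral_gauss_shift[OF \<sigma>, of "\<lambda>e. u (y0 x + e)" "y1 x - y0 x"]
    by (simp add: l_def flip: add.assoc)
  have nonneg: "0 \<le> exp s - 1 - s" for s :: real using exp_ge_add_one_self[of s] by linarith
  have div: "(\<integral>\<^sup>+ e. ennreal (exp (s + l (x, y0 x + e)) - 1 - (s + l (x, y0 x + e))) \<partial>gauss \<sigma>)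
      \<le> ennreal (exp s - 1 - s) + ennreal ((\<delta> / \<sigma>)\<^sup>2 / 2) * indicator B x" for x s
  proof (cases "x \<in> B")
    case True
    have "(y1 x - y0 x)\<^sup>2 \<le> \<delta>\<^sup>2" using \<delta>[of x] by (rule abs_le_square_iff[THEN iffD1, OF order_trans]) simp
    then have "(y1 x - y0 x)\<^sup>2 / (2 * \<sigma>\<^sup>2) \<le> (\<delta> / \<sigma>)\<^sup>2 / 2"
      using \<sigma> by (simp add: power_divide divide_simps)
    then show ?thesis
      using True nonneg[of s] nn_integral_gauss_excess[OF \<sigma>, of s "y1 x - y0 x"]
      by (simp add: l_def flip: ennreal_plus)
  next
    case False
    then show ?thesis
      using nn_integral_gauss_excess[OF \<sigma>, of s 0] by (simp add: l_def eq)
  qed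
  have two: "2 * ennreal ((\<delta> / \<sigma>)\<^sup>2 / 2) = ennreal ((\<delta> / \<sigma>)\<^sup>2)"
    using ennreal_mult[of 2 "(\<delta> / \<sigma>)\<^sup>2 / 2"] by simp
  show ?thesis
    using noisy_change_of_problem[OF y0 y1 K l ratio B div g t] by (simp add: two)
qed

section \<open>A region that is rarely visited\<close>

context query_rule
begin

text \<open>A query hits at most one of the disjoint regions, so each round contributes at most
  1.\<close>

lemma sum_visits_le:
  fixes y :: "real ^ 'd \<Rightarrow> real"
  assumes y: "y \<in> borel_measurable borel" and K: "K \<in> measurable borel (prob_algebra borel)"
    and J: "finite J" and B: "\<And>j. j \<in> J \<Longrightarrow> B j \<in> sets borel" and disj: "disjoint_family_on B J"
    and t: "t \<le> n"
  shows "(\<Sum>j\<in>J. visits y K (B j) t) \<le> of_nat t"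
proof -
  have le1: "(\<Sum>j\<in>J. \<integral>\<^sup>+ h. emeasure (q i h) (B j) \<partial>run y K q i) \<le> 1" if i: "i < t" for i
  proof -
    have i': "i < n" "i \<le> n" using i t by auto
    interpret R: prob_space "run y K q i" by (rule prob_space_run[OF y K i'(2)])
    have m: "(\<lambda>h. emeasure (q i h) (B j)) \<in> borel_measurable (run y K q i)" if "j \<in> J" for j
      using measurable_query_emeasure[OF i'(1) B[OF that]]
      by (simp add: measurable_cong_sets[OF sets_run[OF y K i'(2)] refl])
    have "(\<Sum>j\<in>J. \<integral>\<^sup>+ h. emeasure (q i h) (B j) \<partial>run y K q i)
        = (\<integral>\<^sup>+ h. (\<Sum>j\<in>J. emeasure (q i h) (B j)) \<partial>run y K q i)"
      by (rule nn_integral_sum[symmetric]) (rule m)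
    also have "\<dots> \<le> (\<integral>\<^sup>+ h. 1 \<partial>run y K q i)"
    proof (rule nn_integral_mono)
      fix h assume "h \<in> space (run y K q i)"
      then have h: "h \<in> space (hist_space i)" by (simp add: space_run[OF y K i'(2)])
      interpret Q: prob_space "q i h" by (rule prob_query(1)[OF i'(1) h])
      have "(\<Sum>j\<in>J. emeasure (q i h) (B j)) = emeasure (q i h) (\<Union>j\<in>J. B j)"
        using B prob_query(2)[OF i'(1) h] by (intro sum_emeasure disj J) auto
      then show "(\<Sum>j\<in>J. emeasure (q i h) (B j)) \<le> 1"
        using Q.emeasure_le_1 by simp
    qed
    finally show ?thesis by (simp add: R.emeasure_space_1)
  qed
  have "(\<Sum>j\<in>J. visits y K (B j) t) = (\<Sum>i<t. \<Sum>j\<in>J. \<integral>\<^sup>+ h. emeasure (q i h) (B j) \<partial>run y K q i)"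
    unfolding visits_def by (rule sum.swap)
  also have "\<dots> \<le> (\<Sum>i<t. 1)" by (rule sum_mono) (simp add: le1)
  finally show ?thesis by simp
qed

text \<open>Under \<open>y0\<close> the output probabilities of the regions plus their weighted
  visits sum to at most \<open>1 + w * n\<close>, so for some region the two terms total at most
  1/6. Passing from \<open>y0\<close> to \<open>y j\<close> then leaves a miss probability of at
  least \<open>1 - 1/3 - 1/6 = 1/2\<close>.\<close>

lemma exists_missed_region:
  fixes y0 :: "real ^ 'd \<Rightarrow> real" and y :: "'j \<Rightarrow> real ^ 'd \<Rightarrow> real" and w :: real
  assumes y0: "y0 \<in> borel_measurable borel" and K: "K \<in> measurable borel (prob_algebra borel)"
    and out: "out \<in> measurable (hist_space n) (prob_algebra borel)"
    and J: "finite J" and B: "\<And>j. j \<in> J \<Longrightarrow> B j \<in> sets borel" and disj: "disjoint_family_on B J"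
    and compare: "\<And>j g. \<lbrakk>j \<in> J; g \<in> borel_measurable (hist_space n); \<And>h. g h \<le> (1::ennreal)\<rbrakk> \<Longrightarrow>
      (\<integral>\<^sup>+ h. g h \<partial>run y0 K q n)
        \<le> (\<integral>\<^sup>+ h. g h \<partial>run (y j) K q n) + ennreal (1/3) + ennreal w * visits y0 K (B j) n"
    and w: "0 \<le> w" and card: "6 * (1 + w * real n) \<le> real (card J)"
  shows "\<exists>j\<in>J. ennreal (1/2) \<le> (\<integral>\<^sup>+ h. emeasure (out h) (- B j) \<partial>run (y j) K q n)"
proof -
  interpret R: prob_space "run y0 K q n" by (rule prob_space_run[OF y0 K order_refl])
  have R_sets: "measurable (run y0 K q n) N = measurable (hist_space n) N" for N :: "ennreal measure"
    by (rule measurable_cong_sets[OF sets_run[OF y0 K order_refl] refl])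
  have m: "(\<lambda>h. emeasure (out h) A) \<in> borel_measurable (hist_space n)" if "A \<in> sets borel" for A
    using measurable_prob_algebraD[OF out] that by measurable
  have outp: "prob_space (out h)" "sets (out h) = sets borel" "space (out h) = UNIV" if "h \<in> space (hist_space n)" for h
    using measurable_space[OF out that] by (auto simp: space_prob_algebra dest: sets_eq_imp_space_eq)
  define p where "p j = (\<integral>\<^sup>+ h. emeasure (out h) (B j) \<partial>run y0 K q n) + ennreal w * visits y0 K (B j) n" for j
  have "(\<Sum>j\<in>J. p j) \<le> 1 + ennreal w * of_nat n"
  proof -
    have "(\<Sum>j\<in>J. \<integral>\<^sup>+ h. emeasure (out h) (B j) \<partial>run y0 K q n)
        = (\<integral>\<^sup>+ h. (\<Sum>j\<in>J. emeasure (out h) (B j)) \<partial>run y0 K q n)"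
      by (rule nn_integral_sum[symmetric]) (simp add: R_sets m B)
    also have "\<dots> \<le> (\<integral>\<^sup>+ h. 1 \<partial>run y0 K q n)"
    proof (rule nn_integral_mono)
      fix h assume "h \<in> space (run y0 K q n)"
      then have h: "h \<in> space (hist_space n)" by (simp add: space_run[OF y0 K order_refl])
      have "(\<Sum>j\<in>J. emeasure (out h) (B j)) = emeasure (out h) (\<Union>j\<in>J. B j)"
        using B outp(2)[OF h] by (intro sum_emeasure disj J) auto
      then show "(\<Sum>j\<in>J. emeasure (out h) (B j)) \<le> 1"
        using prob_space.emeasure_le_1[OF outp(1)[OF h]] by simp
    qed
    also have "\<dots> = 1" by (simp add: R.emeasure_space_1)
    finally show ?thesis
      unfolding p_def sum.distrib sum_distrib_left[symmetric]
      by (intro add_mono mult_left_mono sum_visits_le[OF y0 K J B disj]) auto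
  qed
  moreover have "1 + ennreal w * of_nat n = ennreal (1 + w * real n)"
    using w by (simp add: ennreal_mult ennreal_of_nat_eq_real_of_nat)
  ultimately have sum_p: "(\<Sum>j\<in>J. p j) \<le> ennreal (real (card J) * (1/6))"
    using card by (auto intro: order_trans ennreal_leI)
  have "0 < 6 * (1 + w * real n)" using w by (intro mult_pos_pos add_pos_nonneg) auto
  then have "0 < card J" using card by (metis less_le_trans of_nat_0_less_iff)
  then have "J \<noteq> {}" by auto
  \<comment> \<open>The minimum of \<open>p\<close> is at most its average.\<close>
  then obtain j where j: "j \<in> J" and min: "\<And>i. i \<in> J \<Longrightarrow> p j \<le> p i"
    using J by (metis (no_types, opaque_lifting) arg_min_if_finite(1) arg_min_least)
  have "of_nat (card J) * p j \<le> (\<Sum>j\<in>J. p j)" by (rule sum_bounded_below) (rule min)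
  also have "\<dots> \<le> of_nat (card J) * ennreal (1/6)"
    using sum_p unfolding ennreal_of_nat_eq_real_of_nat by (subst ennreal_mult[symmetric]) auto
  finally have pj: "p j \<le> ennreal (1/6)"
    using \<open>0 < card J\<close> by (subst (asm) ennreal_mult_le_mult_iff) (auto simp: ennreal_of_nat_eq_real_of_nat)
  let ?g = "\<lambda>h. emeasure (out h) (- B j)"
  \<comment> \<open>Truncated at 1 because \<open>compare\<close> demands \<open>g h \<le> 1\<close>
    for every \<open>h\<close>, also off the history space, where nothing is known about
    \<open>out h\<close>.\<close>
  let ?X = "\<integral>\<^sup>+ h. min 1 (?g h) \<partial>run (y j) K q n"
  have "1 = (\<integral>\<^sup>+ h. min 1 (?g h) + emeasure (out h) (B j) \<partial>run y0 K q n)"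
  proof -
    have "min 1 (?g h) + emeasure (out h) (B j) = 1" if "h \<in> space (run y0 K q n)" for h
    proof -
      have h: "h \<in> space (hist_space n)" using that by (simp add: space_run[OF y0 K order_refl])
      interpret O: prob_space "out h" by (rule outp(1)[OF h])
      have "?g h + emeasure (out h) (B j) = emeasure (out h) (- B j \<union> B j)"
        using B[OF j] outp(2)[OF h] by (intro plus_emeasure) auto
      then show ?thesis
        using O.emeasure_le_1[of "- B j"] O.emeasure_space_1 outp(3)[OF h] by (simp add: min_absorb2)
    qed
    then have "(\<integral>\<^sup>+ h. min 1 (?g h) + emeasure (out h) (B j) \<partial>run y0 K q n) = (\<integral>\<^sup>+ h. 1 \<partial>run y0 K q n)"
      by (rule nn_integral_cong)
    then show ?thesis by (simp add: R.emeasure_space_1)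
  qed
  also have "\<dots> = (\<integral>\<^sup>+ h. min 1 (?g h) \<partial>run y0 K q n) + (\<integral>\<^sup>+ h. emeasure (out h) (B j) \<partial>run y0 K q n)"
    using B[OF j] by (intro nn_integral_add) (auto simp: R_sets intro!: borel_measurable_min m)
  also have "(\<integral>\<^sup>+ h. min 1 (?g h) \<partial>run y0 K q n)
      \<le> ?X + ennreal (1/3) + ennreal w * visits y0 K (B j) n"
    using B[OF j] by (intro compare[OF j]) (auto intro!: borel_measurable_min m)
  finally have "1 \<le> ?X + ennreal (1/3) + p j" by (simp add: p_def add_ac)
  also have "\<dots> \<le> ?X + ennreal (1/3) + ennreal (1/6)" using pj by (intro add_left_mono)
  also have "\<dots> = ?X + ennreal (1/2)" by (simp add: add.assoc flip: ennreal_plus)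
  finally have "ennreal (1/2) \<le> ?X"
  proof (cases ?X)
    case (real r)
    assume "1 \<le> ?X + ennreal (1/2)"
    moreover have "ennreal r + ennreal (1/2) = ennreal (r + 1/2)"
      using real(1) by (intro ennreal_plus[symmetric]) auto
    ultimately have "ennreal 1 \<le> ennreal (r + 1/2)" using real(2) by (metis ennreal_1)
    then have "1/2 \<le> r" using real(1) by (subst (asm) ennreal_le_iff) auto
    then show ?thesis unfolding real(2) by (rule ennreal_leI)
  qed simp
  also have "?X \<le> (\<integral>\<^sup>+ h. ?g h \<partial>run (y j) K q n)" by (intro nn_integral_mono) auto
  finally show ?thesis using j by blast
qed

end

section \<open>From a missed region to expected regret\<close>

lemma expected_regret_ge:
  fixes y :: "real ^ 'd::finite \<Rightarrow> real"
  assumes "query_rule (Q n) n" and y: "y \<in> borel_measurable borel" and K: "K \<in> measurable borel (prob_algebra borel)"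
    and out: "Out n \<in> measurable (hist_space n) (prob_algebra borel)" and B: "B \<in> sets borel"
    and gap: "\<And>x. x \<notin> B \<Longrightarrow> v \<le> y (maximizer y) - y x"
    and miss: "ennreal p \<le> (\<integral>\<^sup>+ h. emeasure (Out n h) (- B) \<partial>run y K (Q n) n)" and v: "0 \<le> v"
  shows "ennreal (v * p) \<le> expected_regret y K Q Out n"
proof -
  interpret query_rule "Q n" n by fact
  have R: "run y K (Q n) n \<in> space (prob_algebra (hist_space n))"
    by (rule run_in_prob_algebra[OF y K order_refl])
  have s: "sets (output_dist y K Q Out n) = sets borel"
    unfolding output_dist_def by (rule sets_bind'[OF R out])
  have "ennreal (v * p) \<le> ennreal v * (\<integral>\<^sup>+ h. emeasure (Out n h) (- B) \<partial>run y K (Q n) n)"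
    using v by (simp add: ennreal_mult' mult_left_mono miss)
  also have "\<dots> = ennreal v * emeasure (output_dist y K Q Out n) (- B)"
    unfolding output_dist_def using B by (subst emeasure_bind_prob_algebra[OF R out]) auto
  also have "\<dots> = (\<integral>\<^sup>+ x. ennreal v * indicator (- B) x \<partial>output_dist y K Q Out n)"
    using B s by (subst nn_integral_cmult_indicator) auto
  \<comment> \<open>Off \<open>B\<close> the regret is at least \<open>v\<close>; on
    \<open>B\<close> the lower bound is 0, which \<open>ennreal\<close> respects whatever the sign
    of its argument.\<close>
  also have "\<dots> \<le> expected_regret y K Q Out n"
    unfolding expected_regret_def
    using gap by (intro nn_integral_mono) (auto split: split_indicator intro: ennreal_leI)
  finally show ?thesis .
qed

section \<open>Bump functions on a grid\<close>

text \<open>Bounding the sum by twice the larger summand works for every positive exponent, whether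
  the power is convex or concave.\<close>

lemma powr_add_le:
  fixes a u v \<beta> :: real
  assumes "0 \<le> a" "a \<le> u + v" "0 \<le> u" "0 \<le> v" "0 < \<beta>"
  shows "a powr \<beta> \<le> 2 powr \<beta> * (u powr \<beta> + v powr \<beta>)"
proof -
  have "a powr \<beta> \<le> (2 * max u v) powr \<beta>" using assms by (intro powr_mono2) auto
  also have "\<dots> = 2 powr \<beta> * max u v powr \<beta>" using assms by (simp add: powr_mult)
  also have "\<dots> \<le> 2 powr \<beta> * (u powr \<beta> + v powr \<beta>)"
    by (intro mult_left_mono) (auto simp: max_def)
  finally show ?thesis .
qed

section \<open>The max norm and maximizers on the cube\<close>

lemma infnorm_leI:
  fixes x :: "real ^ 'd::finite"
  assumes "\<And>i. \<bar>x $ i\<bar> \<le> c"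
  shows "infnorm x \<le> c"
  unfolding infnorm_cart using assms by (intro cSup_least) auto

lemma infnorm_cube_diff:
  assumes "x \<in> unit_cube" "z \<in> unit_cube"
  shows "infnorm (x - z) \<le> 1"
proof (rule infnorm_leI)
  fix i
  have "0 \<le> x $ i" "x $ i \<le> 1" "0 \<le> z $ i" "z $ i \<le> 1" using assms by (auto simp: unit_cube_def)
  then show "\<bar>(x - z) $ i\<bar> \<le> 1" by simp
qed

lemma measurable_infnorm: "(infnorm :: 'a::euclidean_space \<Rightarrow> real) \<in> borel_measurable borel"
  by (intro borel_measurable_continuous_onI continuous_intros)

lemma maximizer_eqI:
  assumes "z \<in> unit_cube" "\<And>x. x \<in> unit_cube \<Longrightarrow> x \<noteq> z \<Longrightarrow> y x < y z"
  shows "maximizer y = z" "\<exists>!x. x \<in> unit_cube \<and> (\<forall>z\<in>unit_cube. y z \<le> y x)"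
proof -
  have *: "x \<in> unit_cube \<and> (\<forall>z\<in>unit_cube. y z \<le> y x) \<longleftrightarrow> x = z" for x
  proof
    assume "x \<in> unit_cube \<and> (\<forall>z\<in>unit_cube. y z \<le> y x)"
    then show "x = z" using assms(1) assms(2)[of x] by (meson not_le)
  next
    assume "x = z"
    then show "x \<in> unit_cube \<and> (\<forall>z\<in>unit_cube. y z \<le> y x)"
      using assms by (metis less_imp_le order_refl)
  qed
  show "maximizer y = z" unfolding maximizer_def * by simp
  show "\<exists>!x. x \<in> unit_cube \<and> (\<forall>z\<in>unit_cube. y z \<le> y x)" unfolding * by simp
qed

text \<open>The coordinates are multiples of \<open>2 * r\<close> in \<open>[0, R]\<close>. Starting
  at the corner 0 keeps them nonnegative, and \<open>R \<le> 1\<close> keeps the grid in the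
  cube.\<close>

lemma exists_grid:
  fixes R r :: real
  assumes r: "0 < r" and R: "0 \<le> R" "R \<le> 1"
  shows "\<exists>Z :: (real ^ 'd::finite) set. finite Z \<and> Z \<subseteq> unit_cube \<and> (\<forall>z\<in>Z. infnorm z \<le> R) \<and>
    (\<forall>z\<in>Z. \<forall>z'\<in>Z. z \<noteq> z' \<longrightarrow> 2 * r \<le> infnorm (z - z')) \<and>
    (R / (2 * r)) ^ CARD('d) \<le> real (card Z)"
proof -
  \<comment> \<open>Indices run from 0 to \<open>m\<close>, so each axis has \<open>Suc m\<close>
    values, which makes up for the rounding of the floor.\<close>
  define m where "m = nat \<lfloor>R / (2 * r)\<rfloor>"
  have m: "real m * (2 * r) \<le> R" "R / (2 * r) \<le> real (Suc m)"
  proof -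
    have "real m \<le> R / (2 * r)" unfolding m_def using r R by simp
    then show "real m * (2 * r) \<le> R" using r by (simp add: field_simps)
    show "R / (2 * r) \<le> real (Suc m)" unfolding m_def using r R by linarith
  qed
  define P where "P = (UNIV :: 'd set) \<rightarrow>\<^sub>E {..m}"
  define c :: "('d \<Rightarrow> nat) \<Rightarrow> real ^ 'd" where "c j = (\<chi> i. 2 * r * real (j i))" for j
  have coord: "0 \<le> c j $ i" "c j $ i \<le> R" if "j \<in> P" for j i
  proof -
    have "j i \<le> m" using that by (auto simp: P_def PiE_iff)
    then have "real (j i) * (2 * r) \<le> real m * (2 * r)" using r by (intro mult_right_mono) auto
    then show "0 \<le> c j $ i" "c j $ i \<le> R" using r order_trans[OF _ m(1)] by (auto simp: c_def mult_ac)
  qed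
  have sep: "2 * r \<le> infnorm (c j - c j')" if ne: "j \<noteq> j'" for j j'
  proof -
    obtain i where i: "j i \<noteq> j' i" using ne by blast
    then have "1 \<le> \<bar>real (j i) - real (j' i)\<bar>" by linarith
    then have "2 * r * 1 \<le> 2 * r * \<bar>real (j i) - real (j' i)\<bar>" using r by (intro mult_left_mono) auto
    also have "\<dots> = \<bar>(c j - c j') $ i\<bar>" using r by (simp add: c_def abs_mult flip: right_diff_distrib)
    also have "\<dots> \<le> infnorm (c j - c j')" by (rule component_le_infnorm_cart)
    finally show ?thesis by simp
  qed
  have "inj_on c P"
    using sep r by (intro inj_onI) (force simp: infnorm_0)
  then have "card (c ` P) = Suc m ^ CARD('d)"
    by (simp add: card_image P_def card_PiE)
  moreover have "(R / (2 * r)) ^ CARD('d) \<le> real (Suc m) ^ CARD('d)"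
    using m(2) r R by (intro power_mono) auto
  ultimately have "(R / (2 * r)) ^ CARD('d) \<le> real (card (c ` P))" by simp
  moreover have "finite (c ` P)" by (simp add: P_def finite_PiE)
  moreover have "c ` P \<subseteq> unit_cube"
  proof
    fix x assume "x \<in> c ` P"
    then obtain j where "j \<in> P" "x = c j" by blast
    then show "x \<in> unit_cube" using coord[of j] order_trans[OF coord(2) R(2), of j] by (simp add: unit_cube_def)
  qed
  moreover have "\<forall>z\<in>c ` P. infnorm z \<le> R"
  proof
    fix x assume "x \<in> c ` P"
    then obtain j where "j \<in> P" "x = c j" by blast
    then show "infnorm x \<le> R" using coord[of j] by (intro infnorm_leI) simp
  qed
  moreover have "\<forall>z\<in>c ` P. \<forall>z'\<in>c ` P. z \<noteq> z' \<longrightarrow> 2 * r \<le> infnorm (z - z')"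
    using sep by (metis (no_types, lifting) imageE)
  ultimately show ?thesis by (intro exI[of _ "c ` P"] conjI)
qed

text \<open>\<open>hR\<close> makes the height \<open>h\<close> pay for moving the maximizer from 0
  to a center of norm at most \<open>R\<close>. \<open>hr\<close> makes the radius so large that
  outside the bump half of the upper bound \<open>M * u powr \<alpha>\<close>, with \<open>u\<close>
  the distance to the center, covers \<open>(1 + 2 powr \<beta>) * h\<close>.\<close>

locale bump_family =
  fixes \<alpha> \<beta> M Mt h R r :: real
  assumes \<alpha>: "0 < \<alpha>" and \<alpha>\<beta>: "\<alpha> < \<beta>" and Mt: "0 < Mt"
    and M: "2 powr (4 * \<beta> + 1) * Mt \<le> M"
    and h: "0 < h" and r: "0 < r" and rR: "r \<le> R" and R1: "R \<le> 1"
    and hR: "h = 2 powr \<beta> * Mt * R powr \<beta>"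
    and hr: "M * r powr \<alpha> = 2 * (1 + 2 powr \<beta>) * h"
begin

text \<open>The factor \<open>2 powr \<beta>\<close> makes up for the loss in
  \<open>powr_add_le\<close> when distances to 0 are traded for distances to the center of a
  bump.\<close>

definition background :: "real ^ 'd::finite \<Rightarrow> real" where
  "background x = - (2 powr \<beta> * Mt * infnorm x powr \<beta>)"

text \<open>Near \<open>z\<close> the objective falls from its peak as steeply as the class allows.
  The jump at distance \<open>r\<close> is harmless: the class asks for Borel measurability and for
  bounds relative to the maximizer.\<close>

definition bump :: "real ^ 'd::finite \<Rightarrow> real ^ 'd \<Rightarrow> real" where
  "bump z x = (if infnorm (x - z) < r then h - M * infnorm (x - z) powr \<alpha> else background x)"

lemma \<beta>: "0 < \<beta>" using \<alpha> \<alpha>\<beta> by simp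

lemma M_pos: "0 < M"
proof -
  have "0 < 2 powr (4 * \<beta> + 1) * Mt" using Mt by simp
  with M show ?thesis by linarith
qed

text \<open>Half of \<open>M\<close> has to dominate the background coefficient after
  \<open>powr_add_le\<close> has cost another \<open>2 powr \<beta>\<close>. The required ratio of
  \<open>M\<close> to \<open>Mt\<close> enters here.\<close>

lemma M_ge: "2 * (2 powr \<beta> * (2 powr \<beta> * Mt)) \<le> M"
proof -
  have "2 * (2 powr \<beta> * (2 powr \<beta> * Mt)) = 2 powr (2 * \<beta> + 1) * Mt"
    using powr_add[of 2 "2 * \<beta>" 1] powr_add[of 2 \<beta> \<beta>] by simp
  also have "\<dots> \<le> 2 powr (4 * \<beta> + 1) * Mt" using \<beta> Mt by (intro mult_right_mono powr_mono) auto
  finally show ?thesis using M by simp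
qed

lemma background_nonpos: "background x \<le> 0"
  using Mt by (simp add: background_def)

lemma measurable_background: "background \<in> borel_measurable borel"
  unfolding background_def using measurable_infnorm by measurable

lemma measurable_bump: "bump z \<in> borel_measurable borel"
proof -
  have [measurable]: "(\<lambda>x. infnorm (x - z)) \<in> borel_measurable borel"
    by (rule measurable_compose[OF _ measurable_infnorm]) simp
  show ?thesis unfolding bump_def using measurable_background by measurable
qed

lemma bump_center: "bump z z = h"
  using r by (simp add: bump_def infnorm_0)

lemma bump_outside: "r \<le> infnorm (x - z) \<Longrightarrow> bump z x = background x"
  by (simp add: bump_def)

lemma bump_gap: "r \<le> infnorm (x - z) \<Longrightarrow> h \<le> bump z z - bump z x"
  by (simp add: bump_center bump_outside background_nonpos)

lemma bump_less: "x \<noteq> z \<Longrightarrow> bump z x < bump z z"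
proof (cases "infnorm (x - z) < r")
  case True
  assume "x \<noteq> z"
  then have "0 < infnorm (x - z)" by (simp add: infnorm_pos_lt)
  then show ?thesis using True M_pos by (simp add: bump_center) (simp add: bump_def)
next
  case False
  then show ?thesis using bump_gap[of x z] h by auto
qed

text \<open>Let \<open>u\<close> and \<open>a\<close> be the distances of \<open>x\<close> to
  \<open>z\<close> and to 0. Inside the bump the difference equals
  \<open>M * u powr \<alpha>\<close>, and \<open>u \<le> 1\<close> gives the lower bound. Outside,
  it is \<open>h\<close> plus a multiple of \<open>a powr \<beta>\<close>, and the triangle
  inequality trades \<open>a\<close> for \<open>u\<close> at the cost of \<open>R\<close>.\<close>

lemma bump_bounds:
  assumes z: "z \<in> unit_cube" "infnorm z \<le> R" and x: "x \<in> unit_cube"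
  shows "Mt * infnorm (z - x) powr \<beta> \<le> bump z z - bump z x"
    and "bump z z - bump z x \<le> M * infnorm (z - x) powr \<alpha>"
proof -
  define u where "u = infnorm (x - z)"
  have u: "0 \<le> u" "u \<le> 1" "infnorm (z - x) = u"
    using infnorm_cube_diff[OF x z(1)] by (auto simp: u_def infnorm_pos_le infnorm_sub)
  have MtM: "Mt \<le> M"
  proof -
    have "1 * Mt \<le> 2 powr (4 * \<beta> + 1) * Mt" using Mt \<beta> by (intro mult_right_mono ge_one_powr_ge_zero) auto
    then show ?thesis using M by simp
  qed
  have u\<beta>\<alpha>: "u powr \<beta> \<le> u powr \<alpha>" using u \<alpha>\<beta> by (intro powr_mono') auto
  have "Mt * u powr \<beta> \<le> bump z z - bump z x \<and> bump z z - bump z x \<le> M * u powr \<alpha>"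
  proof (cases "u < r")
    case True
    have "Mt * u powr \<beta> \<le> M * u powr \<alpha>" using u\<beta>\<alpha> MtM Mt by (intro mult_mono) auto
    then show ?thesis using True by (simp add: bump_center) (simp add: bump_def u_def)
  next
    case False
    define a where "a = infnorm x"
    have a: "0 \<le> a" by (simp add: a_def infnorm_pos_le)
    have tri: "u \<le> a + R" "a \<le> u + R"
      using infnorm_triangle[of x "- z"] infnorm_triangle[of "x - z" z] z(2)
      by (auto simp: u_def a_def infnorm_neg)
    have R: "0 \<le> R" using r rR by simp
    have diff: "bump z z - bump z x = h + 2 powr \<beta> * Mt * a powr \<beta>"
      using False by (simp add: bump_center bump_outside background_def u_def a_def)
    have "Mt * u powr \<beta> \<le> Mt * (2 powr \<beta> * (a powr \<beta> + R powr \<beta>))"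
      using powr_add_le[OF u(1) tri(1) a R \<beta>] Mt by (intro mult_left_mono) auto
    also have "\<dots> = h + 2 powr \<beta> * Mt * a powr \<beta>" unfolding hR by (simp add: algebra_simps)
    finally have lower: "Mt * u powr \<beta> \<le> h + 2 powr \<beta> * Mt * a powr \<beta>" .
    have "2 powr \<beta> * Mt * a powr \<beta> \<le> 2 powr \<beta> * Mt * (2 powr \<beta> * (u powr \<beta> + R powr \<beta>))"
      using powr_add_le[OF a tri(2) u(1) R \<beta>] Mt by (intro mult_left_mono) auto
    also have "\<dots> = (2 powr \<beta> * (2 powr \<beta> * Mt)) * u powr \<beta> + 2 powr \<beta> * h"
      unfolding hR by (simp add: algebra_simps)
    also have "\<dots> \<le> M / 2 * u powr \<alpha> + 2 powr \<beta> * h"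
      using M_ge Mt u\<beta>\<alpha> M_pos by (intro add_right_mono mult_mono) auto
    \<comment> \<open>Half of the upper bound comes from the background, the other half from
      \<open>(1 + 2 powr \<beta>) * h = M * r powr \<alpha> / 2\<close>.\<close>
    finally have "h + 2 powr \<beta> * Mt * a powr \<beta> \<le> M / 2 * u powr \<alpha> + M * r powr \<alpha> / 2"
      unfolding hr by (simp add: field_simps)
    also have "M * r powr \<alpha> / 2 \<le> M * u powr \<alpha> / 2"
      using False r \<alpha> M_pos by (intro divide_right_mono mult_left_mono powr_mono2) auto
    finally show ?thesis using lower diff by simp
  qed
  then show "Mt * infnorm (z - x) powr \<beta> \<le> bump z z - bump z x"
    "bump z z - bump z x \<le> M * infnorm (z - x) powr \<alpha>" by (auto simp: u)
qed

text \<open>On the bump the norm is at most \<open>2 * R\<close>, so the background lies between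
  \<open>- (2 powr \<beta> * h)\<close> and 0, while the peak drops by at most
  \<open>M * r powr \<alpha>\<close>. This amplitude determines the divergence per visit.\<close>

lemma bump_minus_background:
  assumes z: "infnorm z \<le> R"
  shows "\<bar>bump z x - background x\<bar> \<le> 2 * (1 + 2 powr \<beta>) * h"
proof (cases "infnorm (x - z) < r")
  case True
  have R: "0 \<le> R" using r rR by simp
  have "infnorm x \<le> R + R" using infnorm_triangle[of "x - z" z] z True rR by simp
  then have "infnorm x powr \<beta> \<le> (2 * R) powr \<beta>" using \<beta> by (intro powr_mono2) (auto simp: infnorm_pos_le)
  then have "2 powr \<beta> * Mt * infnorm x powr \<beta> \<le> 2 powr \<beta> * Mt * (2 * R) powr \<beta>"
    using Mt by (intro mult_left_mono) auto
  also have "\<dots> = 2 powr \<beta> * h" unfolding hR using R by (simp add: powr_mult)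
  finally have bg: "- (2 powr \<beta> * h) \<le> background x" by (simp add: background_def)
  have "M * infnorm (x - z) powr \<alpha> \<le> M * r powr \<alpha>"
    using True \<alpha> M_pos by (intro mult_left_mono powr_mono2) (auto simp: infnorm_pos_le)
  then have "M * infnorm (x - z) powr \<alpha> \<le> 2 * (1 + 2 powr \<beta>) * h" by (simp add: hr)
  moreover have "0 \<le> M * infnorm (x - z) powr \<alpha>" using M_pos by simp
  moreover have "0 \<le> 2 powr \<beta> * h" using h by simp
  ultimately show ?thesis
    using True bg background_nonpos[of x] h by (simp add: bump_def abs_le_iff algebra_simps)
next
  case False
  then show ?thesis using h by (simp add: bump_def)
qed

lemma maximizer_bump: "z \<in> unit_cube \<Longrightarrow> maximizer (bump z) = z"
  by (rule maximizer_eqI) (auto intro: bump_less)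

lemma bump_in_CSO_class:
  assumes z: "z \<in> unit_cube" "infnorm z \<le> R" and \<nu>: "\<nu> \<in> space (prob_algebra borel)"
    and sub: "\<And>l. integrable \<nu> (\<lambda>e. exp (l * e))" "\<And>l. (\<integral>e. exp (l * e) \<partial>\<nu>) \<le> exp (l\<^sup>2 * s / 2)"
  shows "(bump z, \<lambda>_. \<nu>) \<in> CSO_class \<alpha> \<beta> M Mt s"
proof -
  have "\<bar>bump z z - bump z x\<bar> = bump z z - bump z x" for x
    using bump_less[of x z] by (cases "x = z") auto
  then have "\<forall>x\<in>unit_cube. Mt * infnorm (maximizer (bump z) - x) powr \<beta> \<le> \<bar>bump z (maximizer (bump z)) - bump z x\<bar>
      \<and> \<bar>bump z (maximizer (bump z)) - bump z x\<bar> \<le> M * infnorm (maximizer (bump z) - x) powr \<alpha>"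
    using bump_bounds[OF z] by (simp add: maximizer_bump[OF z(1)])
  moreover have "\<exists>!x. x \<in> unit_cube \<and> (\<forall>x'\<in>unit_cube. bump z x' \<le> bump z x)"
    by (rule maximizer_eqI(2)[OF z(1)]) (rule bump_less)
  ultimately show ?thesis
    unfolding CSO_class_def mem_Collect_eq prod.case
    by (intro conjI ballI allI measurable_bump measurable_const[OF \<nu>] sub) auto
qed

end

text \<open>The part common to both noise models. \<open>compare\<close> isolates what differs, with
  \<open>w\<close> the price of one visit, and \<open>room\<close> says that the grid has enough
  centers for that price. Regret \<open>h\<close> then occurs with probability at least 1/2.\<close>

lemma (in bump_family) minimax_regret_ge:
  fixes Q :: "nat \<Rightarrow> nat \<Rightarrow> 'd::finite hist \<Rightarrow> (real ^ 'd) measure"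
  assumes adm: "admissible Q Out" and n: "1 \<le> n" and \<nu>: "\<nu> \<in> space (prob_algebra borel)"
    and sub: "\<And>l. integrable \<nu> (\<lambda>e. exp (l * e))" "\<And>l. (\<integral>e. exp (l * e) \<partial>\<nu>) \<le> exp (l\<^sup>2 * s / 2)"
    and compare: "\<And>y B g. \<lbrakk>y \<in> borel_measurable borel; B \<in> sets borel; \<And>x. x \<notin> B \<Longrightarrow> y x = background x;
        \<And>x. \<bar>y x - background x\<bar> \<le> 2 * (1 + 2 powr \<beta>) * h;
        g \<in> borel_measurable (hist_space n); \<And>h. g h \<le> (1::ennreal)\<rbrakk> \<Longrightarrow>
      (\<integral>\<^sup>+ h. g h \<partial>run background (\<lambda>_. \<nu>) (Q n) n)
        \<le> (\<integral>\<^sup>+ h. g h \<partial>run y (\<lambda>_. \<nu>) (Q n) n) + ennreal (1/3)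
          + ennreal w * query_rule.visits (Q n) background (\<lambda>_. \<nu>) B n"
    and w: "0 \<le> w" and room: "6 * (1 + w * real n) \<le> (R / (2 * r)) ^ CARD('d)"
  shows "ennreal (h / 2) \<le> (SUP P\<in>CSO_class \<alpha> \<beta> M Mt s. expected_regret (fst P) (snd P) Q Out n)"
proof -
  have Q: "query_rule (Q n) n" and out: "Out n \<in> measurable (hist_space n) (prob_algebra borel)"
    using adm n by (auto simp: admissible_def query_rule_def)
  interpret query_rule "Q n" n by (rule Q)
  have K: "(\<lambda>_. \<nu>) \<in> measurable borel (prob_algebra borel)" using \<nu> by (rule measurable_const)
  have "0 \<le> R" using r rR by simp
  then obtain Z :: "(real ^ 'd) set" where Z: "finite Z" "Z \<subseteq> unit_cube" "\<And>z. z \<in> Z \<Longrightarrow> infnorm z \<le> R"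
    "\<And>z z'. z \<in> Z \<Longrightarrow> z' \<in> Z \<Longrightarrow> z \<noteq> z' \<Longrightarrow> 2 * r \<le> infnorm (z - z')"
    "(R / (2 * r)) ^ CARD('d) \<le> real (card Z)"
    using exists_grid[OF r _ R1] by meson
  \<comment> \<open>The cubes are open, so centers at distance exactly \<open>2 * r\<close> still
    have disjoint cubes.\<close>
  define B where "B z = {x. infnorm (x - z) < r}" for z :: "real ^ 'd"
  have B: "B z \<in> sets borel" for z
  proof -
    have [measurable]: "(\<lambda>x. infnorm (x - z)) \<in> borel_measurable borel"
      by (rule measurable_compose[OF _ measurable_infnorm]) simp
    show ?thesis unfolding B_def by measurable
  qed
  have disj: "disjoint_family_on B Z"
    unfolding disjoint_family_on_def
  proof (intro ballI impI)
    fix z z' assume "z \<in> Z" "z' \<in> Z" "z \<noteq> z'"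
    then have sep: "2 * r \<le> infnorm (z - z')" by (rule Z(4))
    have "infnorm (z - z') \<le> infnorm (x - z) + infnorm (x - z')" for x
      using infnorm_triangle[of "z - x" "x - z'"] by (simp add: infnorm_sub)
    with sep show "B z \<inter> B z' = {}" unfolding B_def by (smt (verit) disjoint_iff mem_Collect_eq)
  qed
  obtain z where z: "z \<in> Z" and miss: "ennreal (1/2) \<le> (\<integral>\<^sup>+ h. emeasure (Out n h) (- B z) \<partial>run (bump z) (\<lambda>_. \<nu>) (Q n) n)"
  proof -
    have "\<exists>z\<in>Z. ennreal (1/2) \<le> (\<integral>\<^sup>+ h. emeasure (Out n h) (- B z) \<partial>run (bump z) (\<lambda>_. \<nu>) (Q n) n)"
    proof (rule exists_missed_region[OF measurable_background K out Z(1) B disj _ w])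
      show "6 * (1 + w * real n) \<le> real (card Z)" using room Z(5) by simp
    next
      fix z and g :: "'d hist \<Rightarrow> ennreal"
      assume "z \<in> Z" and g: "g \<in> borel_measurable (hist_space n)" "\<And>h. g h \<le> 1"
      then show "(\<integral>\<^sup>+ h. g h \<partial>run background (\<lambda>_. \<nu>) (Q n) n)
        \<le> (\<integral>\<^sup>+ h. g h \<partial>run (bump z) (\<lambda>_. \<nu>) (Q n) n) + ennreal (1/3)
          + ennreal w * visits background (\<lambda>_. \<nu>) (B z) n"
        by (intro compare measurable_bump B bump_minus_background Z(3) g)
           (auto simp: B_def bump_outside)
    qed
    then show ?thesis using that by blast
  qed
  have zc: "z \<in> unit_cube" using z Z(2) by blast
  have "ennreal (h * (1/2)) \<le> expected_regret (bump z) (\<lambda>_. \<nu>) Q Out n"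
    using bump_gap[of _ z] h
    by (intro expected_regret_ge[where Q = Q and n = n and Out = Out, OF Q measurable_bump[of z] K out B[of z] _ miss])
       (auto simp: B_def maximizer_bump[OF zc])
  also have "\<dots> = (\<lambda>P. expected_regret (fst P) (snd P) Q Out n) (bump z, \<lambda>_. \<nu>)" by simp
  also have "\<dots> \<le> (SUP P\<in>CSO_class \<alpha> \<beta> M Mt s. expected_regret (fst P) (snd P) Q Out n)"
    by (rule SUP_upper) (rule bump_in_CSO_class[OF zc Z(3)[OF z] \<nu> sub])
  finally show ?thesis by simp
qed

text \<open>Zero noise satisfies the moment condition for every \<open>s \<ge> 0\<close>, so this
  bound holds at all noise levels. A visit has price 1.\<close>

lemma (in bump_family) minimax_regret_ge_noiseless:
  fixes Q :: "nat \<Rightarrow> nat \<Rightarrow> 'd::finite hist \<Rightarrow> (real ^ 'd) measure"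
  assumes adm: "admissible Q Out" and n: "1 \<le> n" and s: "0 \<le> s"
    and room: "6 * (1 + real n) \<le> (R / (2 * r)) ^ CARD('d)"
  shows "ennreal (h / 2) \<le> (SUP P\<in>CSO_class \<alpha> \<beta> M Mt s. expected_regret (fst P) (snd P) Q Out n)"
proof (rule minimax_regret_ge[OF adm n, where w = 1 and \<nu> = "return borel 0"])
  interpret query_rule "Q n" n using adm n by (auto simp: admissible_def query_rule_def)
  interpret N: prob_space "return borel (0::real)" by (rule prob_space_return) simp
  show "return borel (0::real) \<in> space (prob_algebra borel)"
    by (simp add: space_prob_algebra N.prob_space_axioms)
  have *: "has_bochner_integral (return borel (0::real)) (\<lambda>e. exp (l * e)) 1" for l :: real
  proof -
    have ae: "AE e in return borel (0::real). exp (l * e) = 1" by (subst AE_return) auto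
    have "has_bochner_integral (return borel (0::real)) (\<lambda>e. 1 :: real) 1"
      using N.prob_space by (simp add: has_bochner_integral_iff)
    then show ?thesis
      using ae by (subst has_bochner_integral_cong_AE[where g = "\<lambda>_. 1"]) auto
  qed
  show "integrable (return borel 0) (\<lambda>e. exp (l * e))" for l :: real
    using *[of l] by (simp add: has_bochner_integral_iff)
  show "(\<integral>e. exp (l * e) \<partial>return borel 0) \<le> exp (l\<^sup>2 * s / 2)" for l :: real
    using *[of l] s by (simp add: has_bochner_integral_iff)
  show "6 * (1 + 1 * real n) \<le> (R / (2 * r)) ^ CARD('d)" using room by simp
next
  interpret query_rule "Q n" n using adm n by (auto simp: admissible_def query_rule_def)
  fix y :: "real ^ 'd \<Rightarrow> real" and B and g :: "'d hist \<Rightarrow> ennreal"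
  assume "y \<in> borel_measurable borel" "B \<in> sets borel" "\<And>x. x \<notin> B \<Longrightarrow> y x = background x"
    "g \<in> borel_measurable (hist_space n)" "\<And>h. g h \<le> 1"
  from noiseless_change_of_problem[OF measurable_background this order_refl]
  show "(\<integral>\<^sup>+ h. g h \<partial>run background (\<lambda>_. return borel 0) (Q n) n)
        \<le> (\<integral>\<^sup>+ h. g h \<partial>run y (\<lambda>_. return borel 0) (Q n) n) + ennreal (1/3)
          + ennreal 1 * visits background (\<lambda>_. return borel 0) B n"
    by (simp add: add.assoc) (erule order_trans, intro add_left_mono, simp)
qed simp

text \<open>Normal noise of variance \<open>s\<close> attains equality in the moment condition. The
  price of a visit is the squared amplitude of the bump divided by \<open>s\<close>.\<close>

lemma (in bump_family) minimax_regret_ge_gaussian: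
  fixes Q :: "nat \<Rightarrow> nat \<Rightarrow> 'd::finite hist \<Rightarrow> (real ^ 'd) measure"
  assumes adm: "admissible Q Out" and n: "1 \<le> n" and s: "0 < s"
    and room: "6 * (1 + (2 * (1 + 2 powr \<beta>) * h)\<^sup>2 / s * real n) \<le> (R / (2 * r)) ^ CARD('d)"
  shows "ennreal (h / 2) \<le> (SUP P\<in>CSO_class \<alpha> \<beta> M Mt s. expected_regret (fst P) (snd P) Q Out n)"
proof (rule minimax_regret_ge[OF adm n, where w = "(2 * (1 + 2 powr \<beta>) * h)\<^sup>2 / s" and \<nu> = "gauss (sqrt s)"])
  have \<sigma>: "0 < sqrt s" using s by simp
  show "gauss (sqrt s) \<in> space (prob_algebra borel)" by (rule gauss_in_prob_algebra[OF \<sigma>])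
  show "integrable (gauss (sqrt s)) (\<lambda>e. exp (l * e))" for l
    using has_bochner_integral_gauss_exp[OF \<sigma>, of l] by (simp add: has_bochner_integral_iff)
  show "(\<integral>e. exp (l * e) \<partial>gauss (sqrt s)) \<le> exp (l\<^sup>2 * s / 2)" for l
    using has_bochner_integral_gauss_exp[OF \<sigma>, of l] s by (simp add: has_bochner_integral_iff)
  show "0 \<le> (2 * (1 + 2 powr \<beta>) * h)\<^sup>2 / s" using s by simp
  show "6 * (1 + (2 * (1 + 2 powr \<beta>) * h)\<^sup>2 / s * real n) \<le> (R / (2 * r)) ^ CARD('d)" by (rule room)
next
  have \<sigma>: "0 < sqrt s" using s by simp
  interpret query_rule "Q n" n using adm n by (auto simp: admissible_def query_rule_def)
  fix y :: "real ^ 'd \<Rightarrow> real" and B and g :: "'d hist \<Rightarrow> ennreal"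
  assume *: "y \<in> borel_measurable borel" "B \<in> sets borel" "\<And>x. x \<notin> B \<Longrightarrow> y x = background x"
    and \<delta>: "\<And>x. \<bar>y x - background x\<bar> \<le> 2 * (1 + 2 powr \<beta>) * h"
    and g: "g \<in> borel_measurable (hist_space n)" "\<And>h. g h \<le> 1"
  show "(\<integral>\<^sup>+ h. g h \<partial>run background (\<lambda>_. gauss (sqrt s)) (Q n) n)
        \<le> (\<integral>\<^sup>+ h. g h \<partial>run y (\<lambda>_. gauss (sqrt s)) (Q n) n) + ennreal (1/3)
          + ennreal ((2 * (1 + 2 powr \<beta>) * h)\<^sup>2 / s) * visits background (\<lambda>_. gauss (sqrt s)) B n"
    using gaussian_change_of_problem[OF measurable_background * \<delta> \<sigma> g order_refl] s
    by (simp add: power_divide)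
qed

section \<open>Choice of the bump height\<close>

text \<open>Turns a threshold on the budget, with \<open>x\<close> standing for \<open>1 / n\<close>
  or \<open>s / n\<close>, into an upper bound on the bump height.\<close>

lemma mult_powr_inverse_le:
  fixes a b x c p :: real
  assumes "0 < p" "0 \<le> x" "0 < c" "0 < b" "x * (b / c) powr p \<le> 1"
  shows "b * x powr (1 / p) \<le> c"
proof -
  have "(x * (b / c) powr p) powr (1 / p) \<le> 1 powr (1 / p)"
    using assms by (intro powr_mono2) auto
  then have "x powr (1 / p) * (b / c) \<le> 1"
    using assms by (simp add: powr_mult powr_powr)
  then show ?thesis using assms by (simp add: field_simps)
qed


theorem theorem1:
  fixes \<alpha> \<beta> M Mt :: real
    and Q :: "nat \<Rightarrow> nat \<Rightarrow> 'd::finite hist \<Rightarrow> (real ^ 'd) measure"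
    and Out :: "nat \<Rightarrow> 'd hist \<Rightarrow> (real ^ 'd) measure"
  assumes "0 < \<alpha>" and "\<alpha> < \<beta>" and "0 < M" and "0 < Mt"
    and "M / (2 powr (4 * \<beta> + 1) * Mt) \<ge> 1"
    and "admissible Q Out"
  defines "D \<equiv> real CARD('d) * (1 / \<alpha> - 1 / \<beta>)"
  shows "\<exists>b1 b3 b5 :: real. b1 > 0 \<and> b3 > 0 \<and> b5 > 0 \<and>
    (\<forall>sigma2 :: real. \<forall>n :: nat. sigma2 \<ge> 0 \<longrightarrow> real n \<ge> max (b1 * sigma2) b3 \<longrightarrow>
       (SUP P\<in>CSO_class \<alpha> \<beta> M Mt sigma2. expected_regret (fst P) (snd P) Q Out n)
         \<ge> ennreal (b5 * max ((sigma2 / real n) powr (1 / (D + 2))) (real n powr (- 1 / D))))"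
proof -
  have \<beta>: "0 < \<beta>" using assms(1,2) by simp
  have D: "0 < D" using assms(1,2) by (auto simp: D_def intro!: mult_pos_pos divide_strict_left_mono)
  define A where "A = 2 * (1 + 2 powr \<beta> :: real)"
  define a where "a = 2 powr \<beta> * Mt"
  \<comment> \<open>\<open>R h\<close> and \<open>r h\<close> solve the equations \<open>hR\<close>
    and \<open>hr\<close> of \<open>bump_family\<close> for a given height.\<close>
  define R where "R h = (h / a) powr (1 / \<beta>)" for h
  define r where "r h = (A * h / M) powr (1 / \<alpha>)" for h
  define C where "C = ((1 / a) powr (1 / \<beta>) / (2 * (A / M) powr (1 / \<alpha>))) ^ CARD('d)"
  have A: "0 < A" and a: "0 < a" using assms(4) by (auto simp: A_def a_def add_pos_pos)
  have C: "0 < C" using A a assms(3) by (simp add: C_def)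
  \<comment> \<open>The exponent \<open>D\<close> arises here: each of the \<open>CARD('d)\<close>
    axes contributes a factor of order \<open>h powr (1 / \<beta> - 1 / \<alpha>)\<close>.\<close>
  have card: "(R h / (2 * r h)) ^ CARD('d) = C * h powr (- D)" if h: "0 < h" for h
  proof -
    have "R h / (2 * r h) = (1 / a) powr (1 / \<beta>) / (2 * (A / M) powr (1 / \<alpha>)) * (h powr (1 / \<beta>) / h powr (1 / \<alpha>))"
      using h A a assms(3) powr_mult[of "1 / a" h "1 / \<beta>"] powr_mult[of "A / M" h "1 / \<alpha>"] by (simp add: R_def r_def)
    also have "h powr (1 / \<beta>) / h powr (1 / \<alpha>) = h powr (1 / \<beta> - 1 / \<alpha>)" by (simp add: powr_diff)
    finally have "(R h / (2 * r h)) ^ CARD('d) = C * (h powr (1 / \<beta> - 1 / \<alpha>)) ^ CARD('d)"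
      by (simp only: C_def power_mult_distrib)
    also have "(h powr (1 / \<beta> - 1 / \<alpha>)) ^ CARD('d) = h powr (real CARD('d) * (1 / \<beta> - 1 / \<alpha>))"
      using h by (simp add: powr_power)
    also have "real CARD('d) * (1 / \<beta> - 1 / \<alpha>) = - D" by (simp add: D_def algebra_simps)
    finally show ?thesis .
  qed
  have bumps: "bump_family \<alpha> \<beta> M Mt h (R h) (r h)" if h: "0 < h" "h \<le> a" and room: "1 \<le> C * h powr (- D)" for h
  proof
    show "2 powr (4 * \<beta> + 1) * Mt \<le> M" using assms(4,5) by (simp add: pos_le_divide_eq)
    show "0 < r h" using h A assms(3) by (simp add: r_def)
    \<comment> \<open>The count is a power of \<open>R h / (2 * r h)\<close>, so a count of at least
      1 forces even \<open>2 * r h \<le> R h\<close>.\<close>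
    have "1 ^ CARD('d) \<le> (R h / (2 * r h)) ^ CARD('d)" using room card[OF h(1)] by simp
    then have "1 \<le> R h / (2 * r h)"
      by (subst (asm) power_mono_iff) (simp_all add: R_def r_def)
    then show "r h \<le> R h" using \<open>0 < r h\<close> by (simp add: field_simps)
    have "(h / a) powr (1 / \<beta>) \<le> 1 powr (1 / \<beta>)" using h a \<beta> by (intro powr_mono2) auto
    then show "R h \<le> 1" by (simp add: R_def)
    show "h = 2 powr \<beta> * Mt * R h powr \<beta>" using h a \<beta> by (simp add: R_def powr_powr a_def[symmetric])
    show "M * r h powr \<alpha> = 2 * (1 + 2 powr \<beta>) * h"
      using h A assms(1,3) by (simp add: r_def powr_powr) (simp add: A_def)
  qed (use assms(1,2,4) h in auto)
  \<comment> \<open>With \<open>h = b * n powr (- 1 / D)\<close> the count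
    \<open>C * h powr (- D)\<close> equals \<open>12 * n\<close>. With
    \<open>h = b' * (s / n) powr (1 / (D + 2))\<close> it equals
    \<open>12 * ((A * h)\<^sup>2 / s * n)\<close>. The 12 is twice the 6 required by
    \<open>room\<close>.\<close>
  define b where "b = (C / 12) powr (1 / D)"
  define b' where "b' = (C / (12 * A\<^sup>2)) powr (1 / (D + 2))"
  \<comment> \<open>Heights up to \<open>a\<close> give \<open>R h \<le> 1\<close>, and heights up
    to \<open>b\<close> a count of at least 12.\<close>
  define h0 where "h0 = min a b"
  have b: "0 < b" and b': "0 < b'" and h0: "0 < h0" using C A a by (simp_all add: b_def b'_def h0_def)
  have room_b: "12 \<le> C * h powr (- D)" if "0 < h" "h \<le> b" for h
  proof -
    have "h powr D \<le> b powr D" using that D by (intro powr_mono2) auto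
    also have "\<dots> = C / 12" using C D by (simp add: b_def powr_powr)
    finally show ?thesis using that by (simp add: powr_minus field_simps)
  qed
  \<comment> \<open>The first witness forces the noisy height below \<open>h0\<close>; the second
    gives \<open>n \<ge> 1\<close> and a noiseless height of at most \<open>a\<close>. The 1/2 in
    the third is the probability of a miss.\<close>
  show ?thesis
  proof (rule exI[of _ "(b' / h0) powr (D + 2)"], rule exI[of _ "max 1 ((b / a) powr D)"],
      rule exI[of _ "min b b' / 2"], intro conjI allI impI)
    fix s :: real and n :: nat
    assume s: "0 \<le> s" and "max ((b' / h0) powr (D + 2) * s) (max 1 ((b / a) powr D)) \<le> real n"
    then have n1: "1 \<le> real n" and ns: "(b' / h0) powr (D + 2) * s \<le> real n" and nb: "(b / a) powr D \<le> real n"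
      by auto
    let ?S = "SUP P\<in>CSO_class \<alpha> \<beta> M Mt s. expected_regret (fst P) (snd P) Q Out n"
    have noiseless: "ennreal (b * real n powr (- 1 / D) / 2) \<le> ?S"
    proof -
      define h where "h = b * real n powr (- 1 / D)"
      have h: "0 < h" using b n1 by (simp add: h_def)
      have eq: "h = b * (1 / real n) powr (1 / D)"
        using n1 by (simp add: h_def powr_divide powr_minus_divide)
      have "h \<le> a" unfolding eq using n1 nb D a b by (intro mult_powr_inverse_le) (auto simp: field_simps)
      have "h powr D = C / 12 * (1 / real n)"
        unfolding eq using b n1 D C by (simp add: powr_mult powr_powr b_def)
      then have room: "C * h powr (- D) = 12 * real n"
        using C n1 h by (simp add: powr_minus field_simps)
      interpret bump_family \<alpha> \<beta> M Mt h "R h" "r h" using room n1 by (intro bumps h \<open>h \<le> a\<close>) auto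
      have "ennreal (h / 2) \<le> ?S"
        using n1 room by (intro minimax_regret_ge_noiseless[OF assms(6) _ s]) (auto simp: card[OF h])
      then show ?thesis by (simp add: h_def)
    qed
    have noisy: "ennreal (b' * (s / real n) powr (1 / (D + 2)) / 2) \<le> ?S"
    \<comment> \<open>At \<open>s = 0\<close> the left side is 0, so normal noise is used with
      positive variance only.\<close>
    proof (cases "s = 0")
      case False
      then have s: "0 < s" using s by simp
      define h where "h = b' * (s / real n) powr (1 / (D + 2))"
      have h: "0 < h" using b' s n1 by (simp add: h_def)
      have "h \<le> h0" unfolding h_def using s n1 ns D h0 b'
        by (intro mult_powr_inverse_le) (auto simp: field_simps)
      then have ha: "h \<le> a" and hb: "h \<le> b" by (auto simp: h0_def)
      have "h powr (D + 2) = C / (12 * A\<^sup>2) * (s / real n)"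
        unfolding h_def using b' n1 D C A s by (simp add: powr_mult powr_powr b'_def)
      moreover have "h powr (D + 2) = h powr D * h\<^sup>2" using h by (simp add: powr_add flip: powr_numeral)
      ultimately have "12 * ((A * h)\<^sup>2 / s * real n) = C * h powr (- D)"
        using h s n1 A by (simp add: powr_minus field_simps power_mult_distrib)
      \<comment> \<open>Half of the count pays for the visits; the other half is at least 6 and pays
        for the constant term.\<close>
      then have room: "6 * (1 + (A * h)\<^sup>2 / s * real n) \<le> C * h powr (- D)"
        using room_b[OF h hb] by simp
      interpret bump_family \<alpha> \<beta> M Mt h "R h" "r h" using room_b[OF h hb] by (intro bumps h ha) auto
      have "ennreal (h / 2) \<le> ?S"
        using n1 room by (intro minimax_regret_ge_gaussian[OF assms(6) _ s]) (auto simp: card[OF h] A_def)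
      then show ?thesis by (simp add: h_def)
    qed simp
    let ?x = "(s / real n) powr (1 / (D + 2))" and ?z = "real n powr (- 1 / D)"
    have "min b b' / 2 * max ?x ?z \<le> max (b' * ?x / 2) (b * ?z / 2)"
    proof (cases "?x \<le> ?z")
      case True
      then have "min b b' / 2 * max ?x ?z \<le> b / 2 * ?z" by (auto intro!: mult_right_mono simp: max_def)
      then show ?thesis by simp
    next
      case False
      then have "min b b' / 2 * max ?x ?z \<le> b' / 2 * ?x" by (auto intro!: mult_right_mono simp: max_def)
      then show ?thesis by simp
    qed
    then have "ennreal (min b b' / 2 * max ?x ?z) \<le> ennreal (max (b' * ?x / 2) (b * ?z / 2))" by (rule ennreal_leI)
    also have "\<dots> \<le> ?S" using noiseless noisy by (auto simp: max_def)
    finally show "ennreal (min b b' / 2 * max ?x ?z) \<le> ?S" .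
  qed (use b b' h0 in auto)
qed

end
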